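(* For every distortion vector $\mathbf{D}=(D_1,\dots,D_m)$, the rate-distortion function satisfies $R(\mathbf{D})\le R_{ach}(\mathbf{D})$, where $R_{ach}(\mathbf{D})$ is the lower convex envelope (as a function of $\mathbf{D}$) of $$R'_{ach}(\mathbf{D})=\min_{v\in\mathcal{V}}\ \inf_{p\in C_{ach,v}(\mathbf{D})}\ \inf_{(R_{\mathcal{S}_j},R'_{\mathcal{S}_j})_j\in C^{LP}_{ach}(p)}\ \sum_{j=1}^{2^m-1}R_{\mathcal{S}_j}.$$ Here, for an ordering $v=(\mathcal{S}_1,\dots,\mathcal{S}_{2^m-1})$, $C_{ach,v}(\mathbf{D})$ is the set of joint distributions $p$ of $(U_{\mathcal{S}_1},\dots,U_{\mathcal{S}_{2^m-1}},X,Y_1,\dots,Y_m)$, where each $U_{\mathcal{S}_j}$ takes values in some finite alphabet, such that: (1) the marginal of $(X,Y_1,\dots,Y_m)$ under $p$ equals the given source/side-information distribution; (2) $\mathcal{U}\leftrightarrow X\leftrightarrow (Y_1,\dots,Y_m)$ is a Markov chain; (3) for every $l\in[m]$ there is a function $g_l$ with $E[d_l(X,g_l(U_{\mathcal{D}_l},Y_l))]\le D_l$. And $C^{LP}_{ach}(p)$ is the set of nonnegative reals $R_{\mathcal{S}_j},R'_{\mathcal{S}_j}$, $j\in[2^m-1]$, such that (i) $R_{\mathcal{S}_j}\ge I(X,U^-_{\mathcal{S}_j};U_{\mathcal{S}_j})-R'_{\mathcal{S}_j}$ for all $j$; and (ii) for every decoder $l\in[m]$ and every nonempty $\mathcal{D}'_l\subseteq\mathcal{D}_l$,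 $$\sum_{\mathcal{S}_j\in\mathcal{D}'_l}R'_{\mathcal{S}_j}\le \sum_{\mathcal{S}_j\in\mathcal{D}'_l}H(U_{\mathcal{S}_j})-H\big(U_{\mathcal{D}'_l}\,\big|\,U_{\mathcal{D}_l\setminus\mathcal{D}'_l},Y_l\big),$$ all information quantities being computed under $p$.
   Context: Setting (finite alphabets): a source $X$ on finite alphabet $\mathcal{X}$ and side informations $Y_1,\dots,Y_m$ on finite alphabets $\mathcal{Y}_l$, with a given joint distribution of $(X,Y_1,\dots,Y_m)$; the sequence $(X_k,Y_{1k},\dots,Y_{mk})_{k\ge1}$ is i.i.d. Reconstruction alphabets $\widehat{\mathcal{X}}_l$ are finite and $d_l:\mathcal{X}\times\widehat{\mathcal{X}}_l\to[0,\infty)$ are distortion measures. An $(n,M,\mathbf{D})$ code consists of an encoder $f:\mathcal{X}^n\to\{1,\dots,M\}$ and decoders $g_l:\{1,\dots,M\}\times\mathcal{Y}_l^n\to\widehat{\mathcal{X}}_l^n$, $l\in[m]$, such that with $\widehat{X}_l^n=g_l(f(X^n),Y_l^n)$ one has $E[\frac1n\sum_{k=1}^n d_l(X_k,\widehat{X}_{lk})]\le D_l$ for all $l$. A rate $R$ is $\mathbf{D}$-achievable if for every $\epsilon>0$ and all sufficiently large $n$ there is an $(n,M,\mathbf{D}+\epsilon\mathbf{1})$ code with $\frac1n\log M\le R+\epsilon$; $R(\mathbf{D})$ is the infimum of $\mathbf{D}$-achievable rates. Notation: $\mathcal{V}$ is the set of all orderings $v=(\mathcal{S}_1,\dots,\mathcal{S}_{2^m-1})$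 of the nonempty subsets of $[m]$. For a fixed $v$, there is one auxiliary random variable $U_{\mathcal{S}_j}$ per subset, and $\mathcal{U}=\{U_{\mathcal{S}_1},\dots,U_{\mathcal{S}_{2^m-1}}\}$. $\mathcal{D}_l=\{\mathcal{S}_i: l\in\mathcal{S}_i\}$; for $\mathcal{D}'_l\subseteq\mathcal{D}_l$, $U_{\mathcal{D}'_l}=\{U_{\mathcal{S}_i}:\mathcal{S}_i\in\mathcal{D}'_l\}$; $U^-_{\mathcal{S}_j}=\{U_{\mathcal{S}_i}: i<j\}$ (variables earlier in the order $v$). *)

theory Defs
  imports "HOL-Probability.Probability"
begin

definition ent :: "'a pmf \<Rightarrow> ('a \<Rightarrow> 'b) \<Rightarrow> real" where
  "ent p f = - (\<Sum>b\<in>f ` set_pmf p. pmf (map_pmf f p) b * log 2 (pmf (map_pmf f p) b))"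

definition cent :: "'a pmf \<Rightarrow> ('a \<Rightarrow> 'b) \<Rightarrow> ('a \<Rightarrow> 'c) \<Rightarrow> real" where
  "cent p f g = ent p (\<lambda>w. (f w, g w)) - ent p g"

definition minf :: "'a pmf \<Rightarrow> ('a \<Rightarrow> 'b) \<Rightarrow> ('a \<Rightarrow> 'c) \<Rightarrow> real" where
  "minf p f g = ent p f + ent p g - ent p (\<lambda>w. (f w, g w))"

definition markov :: "'a pmf \<Rightarrow> ('a \<Rightarrow> 'b) \<Rightarrow> ('a \<Rightarrow> 'c) \<Rightarrow> ('a \<Rightarrow> 'e) \<Rightarrow> bool" where
  "markov p A B C \<longleftrightarrow> (\<forall>a b c.
     pmf (map_pmf (\<lambda>w. (A w, B w, C w)) p) (a, b, c) * pmf (map_pmf B p) b =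
     pmf (map_pmf (\<lambda>w. (A w, B w)) p) (a, b) * pmf (map_pmf (\<lambda>w. (B w, C w)) p) (b, c))"

text \<open>Decoders are indexed by the finite type 'm.  The source distribution P is a pmf of
  (X, (Y_l)_l).  Reconstruction alphabet of decoder l is the finite set Xhat l.\<close>

definition is_code ::
  "('x \<times> ('m \<Rightarrow> 'y)) pmf \<Rightarrow> ('m \<Rightarrow> 'x \<Rightarrow> 'z \<Rightarrow> real) \<Rightarrow> ('m \<Rightarrow> 'z set) \<Rightarrow>
   nat \<Rightarrow> nat \<Rightarrow> ('m \<Rightarrow> real) \<Rightarrow> ((nat \<Rightarrow> 'x) \<Rightarrow> nat) \<Rightarrow> ('m \<Rightarrow> nat \<Rightarrow> (nat \<Rightarrow> 'y) \<Rightarrow> (nat \<Rightarrow> 'z)) \<Rightarrow> bool"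
where
  "is_code P d Xhat n M D f g \<longleftrightarrow>
     (\<forall>xs. f xs \<in> {1..M}) \<and>
     (\<forall>l i ys k. k < n \<longrightarrow> g l i ys k \<in> Xhat l) \<and>
     (\<forall>l. measure_pmf.expectation (Pi_pmf {..<n} undefined (\<lambda>_. P))
            (\<lambda>w. (1 / real n) * (\<Sum>k<n. d l (fst (w k))
                 (g l (f (\<lambda>k. fst (w k))) (\<lambda>k. snd (w k) l) k))) \<le> D l)"

definition achievable ::
  "('x \<times> ('m \<Rightarrow> 'y)) pmf \<Rightarrow> ('m \<Rightarrow> 'x \<Rightarrow> 'z \<Rightarrow> real) \<Rightarrow> ('m \<Rightarrow> 'z set) \<Rightarrow>
   ('m \<Rightarrow> real) \<Rightarrow> real \<Rightarrow> bool"
where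
  "achievable P d Xhat D R \<longleftrightarrow>
     (\<forall>\<epsilon>>0. \<exists>N. \<forall>n\<ge>N. \<exists>M f g.
        is_code P d Xhat n M (\<lambda>l. D l + \<epsilon>) f g \<and> log 2 (real M) / real n \<le> R + \<epsilon>)"

text \<open>rate-distortion function R(D) (infimum in the extended reals; +\<infinity> if no rate is achievable)\<close>
definition RD ::
  "('x \<times> ('m \<Rightarrow> 'y)) pmf \<Rightarrow> ('m \<Rightarrow> 'x \<Rightarrow> 'z \<Rightarrow> real) \<Rightarrow> ('m \<Rightarrow> 'z set) \<Rightarrow> ('m \<Rightarrow> real) \<Rightarrow> ereal"
where
  "RD P d Xhat D = Inf (ereal ` {R. achievable P d Xhat D R})"

text \<open>Joint distributions p of (U, X, Y) are pmfs on ('m set \<Rightarrow> nat) \<times> 'x \<times> ('m \<Rightarrow> 'y);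
  the first component w gives U_S = w S for each nonempty subset S of decoders
  (values at the empty set are ignored).  Finite support makes every U_S finite-valued.\<close>

definition nesubs :: "'m set set" where
  "nesubs = {S. S \<noteq> {}}"

definition Dset :: "'m \<Rightarrow> 'm set set" where
  "Dset l = {S. l \<in> S}"

definition orderings :: "'m set list set" where
  "orderings = {vs. distinct vs \<and> set vs = nesubs}"

definition Cach ::
  "('x \<times> ('m \<Rightarrow> 'y)) pmf \<Rightarrow> ('m \<Rightarrow> 'x \<Rightarrow> 'z \<Rightarrow> real) \<Rightarrow> ('m \<Rightarrow> 'z set) \<Rightarrow> 'm set list \<Rightarrow>
   ('m \<Rightarrow> real) \<Rightarrow> (('m set \<Rightarrow> nat) \<times> 'x \<times> ('m \<Rightarrow> 'y)) pmf set"
where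
  "Cach P d Xhat vs D = {p.
     finite (set_pmf p) \<and>
     map_pmf snd p = P \<and>
     markov p (\<lambda>w. restrict (fst w) nesubs) (\<lambda>w. fst (snd w)) (\<lambda>w. snd (snd w)) \<and>
     (\<forall>l. \<exists>g :: ('m set \<Rightarrow> nat) \<Rightarrow> 'y \<Rightarrow> 'z.
          (\<forall>u y. g u y \<in> Xhat l) \<and>
          measure_pmf.expectation p
            (\<lambda>w. d l (fst (snd w)) (g (restrict (fst w) (Dset l)) (snd (snd w) l))) \<le> D l)}"

definition CLP ::
  "'m set list \<Rightarrow> (('m set \<Rightarrow> nat) \<times> 'x \<times> ('m \<Rightarrow> 'y)) pmf \<Rightarrow>
   (('m set \<Rightarrow> real) \<times> ('m set \<Rightarrow> real)) set"
where
  "CLP vs p = {(R, R').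
     (\<forall>S\<in>nesubs. R S \<ge> 0 \<and> R' S \<ge> 0) \<and>
     (\<forall>j<length vs.
        R (vs ! j) \<ge> minf p (\<lambda>w. (fst (snd w), restrict (fst w) (set (take j vs))))
                              (\<lambda>w. fst w (vs ! j)) - R' (vs ! j)) \<and>
     (\<forall>l D'. D' \<subseteq> Dset l \<and> D' \<noteq> {} \<longrightarrow>
        (\<Sum>S\<in>D'. R' S) \<le> (\<Sum>S\<in>D'. ent p (\<lambda>w. fst w S))
           - cent p (\<lambda>w. restrict (fst w) D')
                    (\<lambda>w. (restrict (fst w) (Dset l - D'), snd (snd w) l)))}"

definition Rach' ::
  "('x \<times> ('m \<Rightarrow> 'y)) pmf \<Rightarrow> ('m \<Rightarrow> 'x \<Rightarrow> 'z \<Rightarrow> real) \<Rightarrow> ('m \<Rightarrow> 'z set) \<Rightarrow> ('m \<Rightarrow> real) \<Rightarrow> ereal"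
where
  "Rach' P d Xhat D =
     (INF vs\<in>orderings. INF p\<in>Cach P d Xhat vs D. INF r\<in>CLP vs p.
        ereal (\<Sum>S\<in>nesubs. fst r S))"

text \<open>lower convex envelope of a function F of the distortion vector: the function whose
  epigraph is the convex hull of the epigraph of F, i.e. the infimum of
  sum_i lam_i F(D_i) over finite convex combinations sum_i lam_i D_i = D\<close>
definition lower_convex_envelope :: "(('m \<Rightarrow> real) \<Rightarrow> ereal) \<Rightarrow> ('m \<Rightarrow> real) \<Rightarrow> ereal" where
  "lower_convex_envelope F D = Inf {(\<Sum>i<k. ereal (lam i) * F (Ds i)) | (k::nat) lam Ds.
     (\<forall>i<k. lam i > 0) \<and> (\<Sum>i<k. lam i) = 1 \<and> (\<forall>l. (\<Sum>i<k. lam i * Ds i l) = D l)}"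

definition Rach ::
  "('x \<times> ('m \<Rightarrow> 'y)) pmf \<Rightarrow> ('m \<Rightarrow> 'x \<Rightarrow> 'z \<Rightarrow> real) \<Rightarrow> ('m \<Rightarrow> 'z set) \<Rightarrow> ('m \<Rightarrow> real) \<Rightarrow> ereal"
where
  "Rach P d Xhat = lower_convex_envelope (Rach' P d Xhat)"

end

theory Submission
  imports Defs "HOL-Real_Asymp.Real_Asymp"
begin

text \<open>
  Random coding with labels in place of codewords.  Let \<open>n\<close> be the block length.  For every subset
  \<open>S\<close>, each word over the alphabet of \<open>U\<^sub>S\<close> gets an independent uniform label below
  \<open>L\<^sub>S \<approx> 2^(n(H(U\<^sub>S) - R'\<^sub>S + \<delta>))\<close>; the words with label below \<open>K\<^sub>S \<approx> 2^(n(R\<^sub>S + 3\<delta>))\<close> are the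
  codewords, and the label of a codeword is its bin.  In the order \<open>v\<close> the encoder picks the first
  codeword that is jointly typical with the source word and with the codewords chosen before.  There
  are about \<open>2^(n H(U\<^sub>S | X, U\<^sub>S\<^sup>-))\<close> candidates, each a codeword with probability \<open>K\<^sub>S / L\<^sub>S\<close>, so by
  constraint (i) the choice fails with doubly exponentially small probability, and a union bound over
  all source words and all earlier choices suffices.

  A decoder errs only if some other typical tuple carries the same labels on a nonempty
  \<open>D' \<subseteq> D\<^sub>l\<close>.  Given the choice of the encoder, another word is either independent of it or
  known to be no codeword, so each of the at most \<open>2^(n(H(U\<^sub>D\<^sub>' | \<dots>) + \<delta>/2))\<close> wrong tuples is confusable
  with probability at most \<open>\<Prod>\<^sub>S 1 / L\<^sub>S\<close>, and constraint (ii) makes the sum vanish.  Labels need no lower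
  bound on \<open>R'\<^sub>S\<close>, which removes the case distinction \<open>R'\<^sub>S = 0\<close>.  The convex envelope is
  obtained by concatenating codes.
\<close>

section \<open>Robust typicality\<close>

text \<open>The tolerance is relative to \<open>pmf p s\<close> (robust typicality). Symbols outside
  the support therefore cannot occur, and images under functions keep the same tolerance.\<close>

definition typical :: "'s pmf \<Rightarrow> nat \<Rightarrow> real \<Rightarrow> (nat \<Rightarrow> 's) \<Rightarrow> bool" where
  "typical p n e w \<longleftrightarrow>
     (\<forall>s. \<bar>real (card {k\<in>{..<n}. w k = s}) - real n * pmf p s\<bar> \<le> e * (real n * pmf p s))"

lemma typical_cong: "(\<And>k. k < n \<Longrightarrow> w k = w' k) \<Longrightarrow> typical p n e w \<longleftrightarrow> typical p n e w'"
proof -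
  assume "\<And>k. k < n \<Longrightarrow> w k = w' k"
  then have "{k\<in>{..<n}. w k = s} = {k\<in>{..<n}. w' k = s}" for s by auto
  then show ?thesis unfolding typical_def by simp
qed

lemma typical_in_set_pmf:
  assumes "typical p n e w" "k < n"
  shows "w k \<in> set_pmf p"
proof (rule ccontr)
  assume "w k \<notin> set_pmf p"
  then have 0: "pmf p (w k) = 0" by (simp add: set_pmf_iff)
  have "real (card {i\<in>{..<n}. w i = w k}) \<le> 0"
    using assms(1)[unfolded typical_def, THEN spec, of "w k"] unfolding 0 by simp
  then have "{i\<in>{..<n}. w i = w k} = {}" by simp
  with assms(2) show False by auto
qed

text \<open>Grouping positions by symbol turns the sum into one over counts; as \<open>h\<close> is
  nonnegative, the relative errors of the counts combine to the same relative error. Indicators,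
  log-likelihoods and distortions all serve as \<open>h\<close> later.\<close>

lemma typical_average:
  assumes fin: "finite (set_pmf p)" and t: "typical p n e w"
    and h: "\<And>s. s \<in> set_pmf p \<Longrightarrow> h s \<ge> 0"
  shows "\<bar>(\<Sum>k<n. h (w k)) - real n * (\<Sum>s\<in>set_pmf p. pmf p s * h s)\<bar>
           \<le> e * (real n * (\<Sum>s\<in>set_pmf p. pmf p s * h s))"
proof -
  let ?N = "\<lambda>s. real (card {k\<in>{..<n}. w k = s})"
  have "(\<Sum>k<n. h (w k)) = (\<Sum>s\<in>set_pmf p. \<Sum>k\<in>{k\<in>{..<n}. w k = s}. h (w k))"
    using typical_in_set_pmf[OF t] by (intro sum.group[symmetric] fin) auto
  also have "\<dots> = (\<Sum>s\<in>set_pmf p. ?N s * h s)"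
    by (intro sum.cong) auto
  finally have "\<bar>(\<Sum>k<n. h (w k)) - real n * (\<Sum>s\<in>set_pmf p. pmf p s * h s)\<bar>
      = \<bar>\<Sum>s\<in>set_pmf p. (?N s - real n * pmf p s) * h s\<bar>"
    by (simp add: sum_subtractf sum_distrib_left algebra_simps)
  also have "\<dots> \<le> (\<Sum>s\<in>set_pmf p. \<bar>(?N s - real n * pmf p s) * h s\<bar>)" by (rule sum_abs)
  also have "\<dots> \<le> (\<Sum>s\<in>set_pmf p. e * (real n * pmf p s) * h s)"
    using t h unfolding typical_def by (intro sum_mono) (auto simp: abs_mult intro!: mult_right_mono)
  also have "\<dots> = e * (real n * (\<Sum>s\<in>set_pmf p. pmf p s * h s))"
    by (simp add: sum_distrib_left algebra_simps)
  finally show ?thesis .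
qed

lemma pmf_map_eq_sum:
  assumes "finite (set_pmf p)"
  shows "pmf (map_pmf f p) t = (\<Sum>s\<in>set_pmf p. pmf p s * (if f s = t then 1 else 0))"
proof -
  have "pmf (map_pmf f p) t = measure p (f -` {t})" by (simp add: pmf_map)
  also have "\<dots> = measure p (f -` {t} \<inter> set_pmf p)" by (simp add: measure_Int_set_pmf)
  also have "\<dots> = (\<Sum>s\<in>f -` {t} \<inter> set_pmf p. pmf p s)"
    using assms by (subst measure_measure_pmf_finite) auto
  also have "\<dots> = (\<Sum>s\<in>set_pmf p. pmf p s * (if f s = t then 1 else 0))"
    using assms by (intro sum.mono_neutral_cong_left) auto
  finally show ?thesis .
qed

text \<open>The count of an image symbol is the block sum of the indicator of its fibre, so
  averaging applies without loss in \<open>e\<close>.\<close>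

lemma typical_map:
  assumes fin: "finite (set_pmf p)" and t: "typical p n e w"
  shows "typical (map_pmf f p) n e (\<lambda>k. f (w k))"
  unfolding typical_def
proof
  fix s
  have "(\<Sum>k<n. if f (w k) = s then 1 else 0 :: real) = real (card {k\<in>{..<n}. f (w k) = s})"
    by (simp add: sum.If_cases Int_def)
  with typical_average[OF fin t, of "\<lambda>a. if f a = s then 1 else 0"]
  show "\<bar>real (card {k\<in>{..<n}. f (w k) = s}) - real n * pmf (map_pmf f p) s\<bar>
      \<le> e * (real n * pmf (map_pmf f p) s)"
    unfolding pmf_map_eq_sum[OF fin] by simp
qed

text \<open>Hoeffding's tail for one symbol count, at deviation \<open>c\<close> times the least
  positive probability, multiplied by the support size for a union bound.\<close>

definition atyp_bound :: "'s pmf \<Rightarrow> real \<Rightarrow> nat \<Rightarrow> real" where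
  "atyp_bound q c n = 2 * real (card (set_pmf q)) *
     exp (- 2 * real n * (c * Min (pmf q ` set_pmf q))\<^sup>2)"

lemma Min_pmf_pos: "finite (set_pmf q) \<Longrightarrow> Min (pmf q ` set_pmf q) > 0"
  using set_pmf_not_empty[of q] by (subst Min_gr_iff) (auto simp: pmf_positive)

lemma atyp_bound_tendsto_0:
  assumes "finite (set_pmf q)" "c > 0"
  shows "atyp_bound q c \<longlonglongrightarrow> 0"
proof -
  define b where "b = (c * Min (pmf q ` set_pmf q))\<^sup>2"
  have b: "b > 0" using Min_pmf_pos[OF assms(1)] assms(2) unfolding b_def by simp
  have "(\<lambda>n. exp (- 2 * b) ^ n) \<longlonglongrightarrow> 0"
    by (intro LIMSEQ_realpow_zero) (use b in auto)
  then have "(\<lambda>n. 2 * real (card (set_pmf q)) * exp (- 2 * b) ^ n) \<longlonglongrightarrow> 0"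
    by (rule tendsto_mult_right_zero)
  then show ?thesis
    unfolding atyp_bound_def b_def[symmetric] by (simp add: exp_of_nat_mult[symmetric] mult_ac)
qed

text \<open>Hoeffding's inequality for independent indicators that need not be identically
  distributed: law and event may both vary with the position.\<close>

lemma prob_count_deviation:
  fixes r :: "nat \<Rightarrow> 'b pmf"
  assumes n: "n > 0" and c: "c \<ge> 0"
  shows "measure (Pi_pmf {..<n} dflt r)
      {w. \<bar>real (card {k\<in>{..<n}. w k \<in> B k}) - (\<Sum>k<n. measure (r k) (B k))\<bar> \<ge> real n * c}
      \<le> 2 * exp (- 2 * real n * c\<^sup>2)"
proof -
  let ?M = "Pi_pmf {..<n} dflt r"
  let ?X = "\<lambda>k w. indicat_real (B k) (w k)"
  have ind: "prob_space.indep_vars (measure_pmf ?M) (\<lambda>_. borel) ?X {..<n}"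
    by (rule prob_space.indep_vars_compose2[OF measure_pmf.prob_space_axioms indep_vars_Pi_pmf]) auto
  have ex: "measure_pmf.expectation ?M (?X k) = measure (r k) (B k)" if "k < n" for k
  proof -
    have "measure_pmf.expectation ?M (?X k) =
        measure_pmf.expectation (map_pmf (\<lambda>w. w k) ?M) (indicat_real (B k))"
      by (simp only: integral_map_pmf)
    also have "\<dots> = measure (r k) (B k)"
      using that by (subst Pi_pmf_component) auto
    finally show ?thesis .
  qed
  interpret Hoeffding_ineq "measure_pmf ?M" "{..<n}" ?X "\<lambda>_. 0" "\<lambda>_. 1"
      "\<Sum>k<n. measure_pmf.expectation ?M (?X k)"
    by unfold_locales (use ind in \<open>auto simp: indicator_def\<close>)
  have s: "(\<Sum>k<n. ?X k w) = real (card {k\<in>{..<n}. w k \<in> B k})" for w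
    by (simp add: indicator_def sum.If_cases Int_def)
  have "measure ?M {w. \<bar>(\<Sum>k<n. ?X k w) - (\<Sum>k<n. measure_pmf.expectation ?M (?X k))\<bar> \<ge> real n * c}
      \<le> 2 * exp (- 2 * (real n * c)\<^sup>2 / real n)"
    using Hoeffding_ineq_abs_ge[of "real n * c"] n c by simp
  also have "- 2 * (real n * c)\<^sup>2 / real n = - 2 * real n * c\<^sup>2"
    using n by (simp add: power2_eq_square field_simps)
  finally show ?thesis unfolding s using ex by simp
qed

text \<open>\<open>\<phi> k\<close> combines the random symbol with the \<open>k\<close>-th symbols of the sequences that are already
  fixed, so that the source word, the codewords and the side information are all covered.\<close>

lemma prob_atypical:
  fixes r :: "nat \<Rightarrow> 'b pmf" and \<phi> :: "nat \<Rightarrow> 'b \<Rightarrow> 's"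
  assumes fin: "finite (set_pmf q)" and c: "c > 0" and n: "n > 0"
    and mean: "\<And>s. \<bar>(\<Sum>k<n. measure (r k) {b. \<phi> k b = s}) - real n * pmf q s\<bar> \<le> e * (real n * pmf q s)"
  shows "measure (Pi_pmf {..<n} dflt r) {w. \<not> typical q n (e + c) (\<lambda>k. \<phi> k (w k))} \<le> atyp_bound q c n"
proof -
  let ?M = "Pi_pmf {..<n} dflt r"
  define m where "m = Min (pmf q ` set_pmf q)"
  have m: "m > 0" "\<And>s. s \<in> set_pmf q \<Longrightarrow> m \<le> pmf q s"
    using Min_pmf_pos[OF fin] fin by (auto simp: m_def)
  let ?N = "\<lambda>w s. real (card {k\<in>{..<n}. \<phi> k (w k) = s})"
  let ?E = "\<lambda>s. (\<Sum>k<n. measure (r k) {b. \<phi> k b = s})"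
  let ?B = "\<lambda>s. {w. \<bar>real (card {k\<in>{..<n}. w k \<in> {b. \<phi> k b = s}}) - ?E s\<bar> \<ge> real n * (c * m)}"
  have ok: "w \<in> (\<Union>s\<in>set_pmf q. ?B s)" if w: "w \<in> set_pmf ?M" and nt: "\<not> typical q n (e + c) (\<lambda>k. \<phi> k (w k))" for w
  proof -
    obtain s where s: "\<bar>?N w s - real n * pmf q s\<bar> > (e + c) * (real n * pmf q s)"
      using nt unfolding typical_def by (auto simp: not_le)
    \<comment> \<open>A symbol of probability zero has expected count zero, so no word in the
      support of the product produces it. The violating symbol thus has mass at least
      \<open>m\<close>.\<close>
    have "s \<in> set_pmf q"
    proof (rule ccontr)
      assume "s \<notin> set_pmf q"
      then have 0: "pmf q s = 0" by (simp add: set_pmf_iff)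
      with mean[of s] have "?E s = 0" by simp
      then have z: "measure (r k) {b. \<phi> k b = s} = 0" if "k < n" for k
        using that by (subst (asm) sum_nonneg_eq_0_iff) auto
      have "\<phi> k (w k) \<noteq> s" if k: "k < n" for k
      proof -
        have "w k \<in> set_pmf (r k)" using w k by (auto simp: set_Pi_pmf PiE_dflt_def)
        then show ?thesis using z[OF k] by (auto simp: measure_pmf_zero_iff)
      qed
      then have "{k\<in>{..<n}. \<phi> k (w k) = s} = {}" by auto
      with s 0 show False by (simp only: card.empty)
    qed
    \<comment> \<open>The expected count is within relative error \<open>e\<close>, so a violation
      of \<open>e + c\<close> leaves a distance of at least \<open>c * (real n * pmf q s)\<close>
      from it.\<close>
    moreover have "real n * (c * m) \<le> \<bar>?N w s - ?E s\<bar>"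
    proof -
      have "real n * (c * m) \<le> c * (real n * pmf q s)"
        using mult_left_mono[OF m(2)[OF calculation], of "c * real n"] c by (simp add: mult_ac)
      also have "\<dots> \<le> \<bar>?N w s - ?E s\<bar>" using s mean[of s] by (simp add: algebra_simps)
      finally show ?thesis .
    qed
    ultimately show ?thesis by auto
  qed
  have "measure ?M {w. \<not> typical q n (e + c) (\<lambda>k. \<phi> k (w k))} \<le> measure ?M (\<Union>s\<in>set_pmf q. ?B s)"
    by (rule measure_pmf.finite_measure_mono_AE) (use ok in \<open>auto simp: AE_measure_pmf_iff\<close>)
  also have "\<dots> \<le> (\<Sum>s\<in>set_pmf q. measure ?M (?B s))"
    by (intro measure_pmf.finite_measure_subadditive_finite fin) auto
  also have "\<dots> \<le> (\<Sum>s\<in>set_pmf q. 2 * exp (- 2 * real n * (c * m)\<^sup>2))"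
    by (intro sum_mono prob_count_deviation n) (use c m in auto)
  also have "\<dots> = atyp_bound q c n" by (simp add: atyp_bound_def m_def)
  finally show ?thesis .
qed

section \<open>Conditional kernels and entropy\<close>

text \<open>Conditional law of the second component, stated as a factorisation; \<open>K a\<close>
  stays arbitrary where \<open>a\<close> has probability zero.\<close>

definition kernel_of :: "('a \<times> 'b) pmf \<Rightarrow> ('a \<Rightarrow> 'b pmf) \<Rightarrow> bool" where
  "kernel_of q K \<longleftrightarrow> (\<forall>a b. pmf q (a, b) = pmf (map_pmf fst q) a * pmf (K a) b)"

lemma kernel_exists: "\<exists>K. kernel_of q K"
proof -
  define K where "K a = map_pmf snd (cond_pmf q {w. fst w = a})" for a
  have "pmf q (a, b) = pmf (map_pmf fst q) a * pmf (K a) b" for a b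
  proof (cases "set_pmf q \<inter> {w. fst w = a} = {}")
    case True
    then have "(a, b) \<notin> set_pmf q" "a \<notin> set_pmf (map_pmf fst q)" by force+
    then have "pmf q (a, b) = 0" "pmf (map_pmf fst q) a = 0" by (simp_all only: set_pmf_iff not_not)
    then show ?thesis by simp
  next
    case False
    have m: "measure q {w. fst w = a} = pmf (map_pmf fst q) a"
      by (simp add: pmf_map vimage_def)
    have "a \<in> set_pmf (map_pmf fst q)" using False by auto
    then have pos: "pmf (map_pmf fst q) a \<noteq> 0" unfolding set_pmf_iff .
    have "pmf (K a) b = measure (cond_pmf q {w. fst w = a}) (snd -` {b})"
      by (simp add: K_def pmf_map)
    also have "\<dots> = measure (cond_pmf q {w. fst w = a}) {(a, b)}"
      by (intro measure_prob_cong_0) (auto simp: pmf_cond[OF False])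
    also have "\<dots> = pmf q (a, b) / pmf (map_pmf fst q) a"
      by (simp add: measure_pmf_single pmf_cond[OF False] m)
    finally show ?thesis using pos by simp
  qed
  then show ?thesis unfolding kernel_of_def by blast
qed


lemma sum_pmf_map:
  fixes h :: "'b \<Rightarrow> real"
  assumes "finite (set_pmf p)"
  shows "(\<Sum>s\<in>set_pmf (map_pmf f p). pmf (map_pmf f p) s * h s) = (\<Sum>w\<in>set_pmf p. pmf p w * h (f w))"
proof -
  have "(\<Sum>w\<in>set_pmf p. pmf p w * h (f w)) = measure_pmf.expectation p (\<lambda>w. h (f w))"
    using assms by (subst integral_measure_pmf[of "set_pmf p"]) (auto simp: mult.commute)
  also have "\<dots> = measure_pmf.expectation (map_pmf f p) h" by simp
  also have "\<dots> = (\<Sum>s\<in>set_pmf (map_pmf f p). pmf (map_pmf f p) s * h s)"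
    using assms by (subst integral_measure_pmf[of "set_pmf (map_pmf f p)"]) (auto simp: mult.commute)
  finally show ?thesis by simp
qed

text \<open>Every entropy becomes an expectation over the common space, so that differences of
  entropies can be formed term by term.\<close>

lemma ent_eq_sum:
  assumes "finite (set_pmf p)"
  shows "ent p f = (\<Sum>w\<in>set_pmf p. pmf p w * (- log 2 (pmf (map_pmf f p) (f w))))"
  using sum_pmf_map[OF assms, of f "\<lambda>s. - log 2 (pmf (map_pmf f p) s)"]
  by (simp add: ent_def sum_negf)

lemma pmf_map_pos: "w \<in> set_pmf p \<Longrightarrow> pmf (map_pmf f p) (f w) > 0"
  by (simp add: pmf_positive)

lemma pmf_map_swap: "pmf (map_pmf (\<lambda>w. (f w, g w)) p) (a, b) = pmf (map_pmf (\<lambda>w. (g w, f w)) p) (b, a)"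
proof -
  have "(\<lambda>w. (f w, g w)) -` {(a, b)} = (\<lambda>w. (g w, f w)) -` {(b, a)}" by auto
  then show ?thesis by (simp add: pmf_map)
qed

lemma ent_swap: "finite (set_pmf p) \<Longrightarrow> ent p (\<lambda>w. (f w, g w)) = ent p (\<lambda>w. (g w, f w))"
  by (simp add: ent_eq_sum pmf_map_swap[of f g])

lemma minf_eq_cent:
  "finite (set_pmf p) \<Longrightarrow> minf p f g = ent p g - cent p g f"
  by (simp add: minf_def cent_def ent_swap[of p f g])

text \<open>For a kernel \<open>K\<close> of \<open>q\<close> this is the conditional entropy of the
  second component given the first, in the form in which it occurs as the mean of
  log-likelihoods.\<close>

definition kent :: "('a \<times> 'b) pmf \<Rightarrow> ('a \<Rightarrow> 'b pmf) \<Rightarrow> real" where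
  "kent q K = (\<Sum>s\<in>set_pmf q. pmf q s * (- log 2 (pmf (K (fst s)) (snd s))))"

text \<open>The chain rule holds pointwise on the support, where all the probabilities are positive
  and the logarithm of the product splits.\<close>

lemma cent_eq_kent:
  assumes fin: "finite (set_pmf p)" and K: "kernel_of (map_pmf (\<lambda>w. (g w, f w)) p) K"
  shows "cent p f g = kent (map_pmf (\<lambda>w. (g w, f w)) p) K"
proof -
  have *: "log 2 (pmf (map_pmf (\<lambda>w. (f w, g w)) p) (f w, g w)) =
      log 2 (pmf (map_pmf g p) (g w)) + log 2 (pmf (K (g w)) (f w))" if "w \<in> set_pmf p" for w
  proof -
    have eq: "pmf (map_pmf (\<lambda>w. (f w, g w)) p) (f w, g w) = pmf (map_pmf g p) (g w) * pmf (K (g w)) (f w)"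
      using K unfolding kernel_of_def by (subst pmf_map_swap) (simp add: map_pmf_comp)
    moreover have "pmf (map_pmf (\<lambda>w. (f w, g w)) p) (f w, g w) > 0" "pmf (map_pmf g p) (g w) > 0"
      using pmf_map_pos[OF that, of "\<lambda>w. (f w, g w)"] pmf_map_pos[OF that, of g] by auto
    ultimately have "pmf (K (g w)) (f w) > 0" by (simp add: zero_less_mult_iff)
    with eq \<open>pmf (map_pmf g p) (g w) > 0\<close> show ?thesis by (simp add: log_mult)
  qed
  have "cent p f g = (\<Sum>w\<in>set_pmf p. pmf p w * (- log 2 (pmf (K (g w)) (f w))))"
    unfolding cent_def ent_eq_sum[OF fin] sum_subtractf[symmetric]
    by (intro sum.cong) (auto simp: * algebra_simps)
  also have "\<dots> = kent (map_pmf (\<lambda>w. (g w, f w)) p) K"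
    using sum_pmf_map[OF fin, of "\<lambda>w. (g w, f w)" "\<lambda>s. - log 2 (pmf (K (fst s)) (snd s))"]
    by (simp add: kent_def)
  finally show ?thesis .
qed

text \<open>The likelihood is 2 to minus a block sum of the nonnegative function \<open>?h\<close>;
  typical averaging keeps that sum between \<open>1 - e\<close> and \<open>1 + e\<close> times
  \<open>n * kent q K\<close>.\<close>

lemma pmf_kernel_typical_bounds:
  assumes fin: "finite (set_pmf q)" and K: "kernel_of q K"
    and t: "typical q n e (\<lambda>k. (a k, b k))" and b: "\<And>k. k \<ge> n \<Longrightarrow> b k = undefined"
  shows "2 powr (- (1 + e) * (n * kent q K)) \<le> pmf (Pi_pmf {..<n} undefined (\<lambda>k. K (a k))) b" (is "?l \<le> _")
    and "pmf (Pi_pmf {..<n} undefined (\<lambda>k. K (a k))) b \<le> 2 powr (- (1 - e) * (n * kent q K))"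
proof -
  let ?h = "\<lambda>s. - log 2 (pmf (K (fst s)) (snd s))"
  have pos: "pmf (K (fst s)) (snd s) > 0" if "s \<in> set_pmf q" for s
  proof -
    have "pmf q s > 0" using that by (simp add: pmf_positive)
    moreover have "pmf q s = pmf (map_pmf fst q) (fst s) * pmf (K (fst s)) (snd s)"
      using K unfolding kernel_of_def by (metis prod.collapse)
    ultimately show ?thesis by (simp add: zero_less_mult_iff)
  qed
  have posk: "pmf (K (a k)) (b k) > 0" if "k < n" for k
    using pos[OF typical_in_set_pmf[OF t that]] by simp
  have h: "?h s \<ge> 0" if "s \<in> set_pmf q" for s
    using pos[OF that] by (simp add: pmf_le_1)
  have "pmf (Pi_pmf {..<n} undefined (\<lambda>k. K (a k))) b = (\<Prod>k<n. pmf (K (a k)) (b k))"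
    using b by (subst pmf_Pi') auto
  also have "\<dots> = (\<Prod>k<n. 2 powr (- ?h (a k, b k)))" using posk by (intro prod.cong) auto
  also have "\<dots> = 2 powr (\<Sum>k<n. - ?h (a k, b k))" by (simp only: powr_sum)
  finally have eq: "pmf (Pi_pmf {..<n} undefined (\<lambda>k. K (a k))) b = 2 powr (- (\<Sum>k<n. ?h (a k, b k)))"
    by (simp only: sum_negf)
  have av: "\<bar>(\<Sum>k<n. ?h (a k, b k)) - n * kent q K\<bar> \<le> e * (n * kent q K)"
    using typical_average[OF fin t, of ?h] h unfolding kent_def by blast
  show "?l \<le> pmf (Pi_pmf {..<n} undefined (\<lambda>k. K (a k))) b"
    unfolding eq by (rule powr_mono) (use av in \<open>auto simp: algebra_simps\<close>)
  show "pmf (Pi_pmf {..<n} undefined (\<lambda>k. K (a k))) b \<le> 2 powr (- (1 - e) * (n * kent q K))"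
    unfolding eq by (rule powr_mono) (use av in \<open>auto simp: algebra_simps\<close>)
qed

section \<open>Size of conditionally typical sets\<close>

definition cond_typical :: "('a \<times> 'b) pmf \<Rightarrow> nat \<Rightarrow> real \<Rightarrow> (nat \<Rightarrow> 'a) \<Rightarrow> (nat \<Rightarrow> 'b) set" where
  "cond_typical q n e a = {b. (\<forall>k\<ge>n. b k = undefined) \<and> typical q n e (\<lambda>k. (a k, b k))}"

lemma cond_typical_subset: "cond_typical q n e a \<subseteq> PiE {..<n} (\<lambda>_. snd ` set_pmf q)"
proof
  fix b assume b: "b \<in> cond_typical q n e a"
  have "b k \<in> snd ` set_pmf q" if "k < n" for k
    using typical_in_set_pmf[of q n e "\<lambda>k. (a k, b k)" k] b that
    by (force simp: cond_typical_def)
  with b show "b \<in> PiE {..<n} (\<lambda>_. snd ` set_pmf q)"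
    by (auto simp: cond_typical_def PiE_iff extensional_def)
qed

lemma finite_cond_typical: "finite (set_pmf q) \<Longrightarrow> finite (cond_typical q n e a)"
  by (rule finite_subset[OF cond_typical_subset]) (auto intro: finite_PiE)

text \<open>Each member has at least the lower likelihood bound under the product of the kernels,
  and the total mass is at most one.\<close>

lemma card_cond_typical_le:
  assumes fin: "finite (set_pmf q)" and K: "kernel_of q K"
  shows "real (card (cond_typical q n e a)) \<le> 2 powr ((1 + e) * (n * kent q K))"
proof -
  let ?T = "cond_typical q n e a" and ?M = "Pi_pmf {..<n} undefined (\<lambda>k. K (a k))"
  have "real (card ?T) * 2 powr (- (1 + e) * (n * kent q K)) = (\<Sum>b\<in>?T. 2 powr (- (1 + e) * (n * kent q K)))"
    by simp
  also have "\<dots> \<le> (\<Sum>b\<in>?T. pmf ?M b)"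
    by (intro sum_mono pmf_kernel_typical_bounds(1)[OF fin K]) (auto simp: cond_typical_def)
  also have "\<dots> = measure ?M ?T"
    by (rule measure_measure_pmf_finite[symmetric, OF finite_cond_typical[OF fin]])
  also have "\<dots> \<le> 1" by simp
  finally show ?thesis unfolding mult_minus_left powr_minus by (simp add: field_simps)
qed

text \<open>Given \<open>a\<close>, the expected count of a pair is the count of \<open>s\<close> in
  \<open>a\<close> times \<open>pmf (K s) t\<close>, so the relative error of \<open>a\<close> is
  inherited. Only the factorisation of \<open>q\<close> enters, which also covers side information
  drawn through a Markov chain.\<close>

lemma expected_count_kernel:
  assumes K: "\<And>b. pmf q (s, b) = pmf pa s * pmf (K s) b" and t: "typical pa n e a"
  shows "\<bar>(\<Sum>k<n. measure (K (a k)) {b. (a k, b) = (s, t)}) - real n * pmf q (s, t)\<bar>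
     \<le> e * (real n * pmf q (s, t))"
proof -
  have "(\<Sum>k<n. measure (K (a k)) {b. (a k, b) = (s, t)}) = (\<Sum>k<n. if a k = s then pmf (K s) t else 0)"
    by (intro sum.cong) (auto simp: measure_pmf_single)
  also have "\<dots> = real (card {k\<in>{..<n}. a k = s}) * pmf (K s) t"
    by (simp add: sum.If_cases Int_def)
  finally have "\<bar>(\<Sum>k<n. measure (K (a k)) {b. (a k, b) = (s, t)}) - real n * pmf q (s, t)\<bar>
      = \<bar>real (card {k\<in>{..<n}. a k = s}) - real n * pmf pa s\<bar> * pmf (K s) t"
    unfolding K by (subst abs_of_nonneg[OF pmf_nonneg[of "K s" t], symmetric], subst abs_mult[symmetric])
      (simp add: algebra_simps)
  also have "\<dots> \<le> e * (real n * pmf pa s) * pmf (K s) t"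
    using t unfolding typical_def by (intro mult_right_mono) auto
  finally show ?thesis by (simp add: K mult_ac)
qed

text \<open>A word drawn from the kernels along \<open>a\<close> is jointly typical with probability
  at least one half, while each typical word has at most the upper likelihood bound. The slack
  \<open>c\<close> pays for the concentration.\<close>

lemma card_cond_typical_ge:
  fixes q :: "('a \<times> 'b) pmf"
  assumes fin: "finite (set_pmf q)" and K: "kernel_of q K" and c: "c > 0" and n: "n > 0"
    and t: "typical (map_pmf fst q) n e a" and small: "atyp_bound q c n \<le> 1 / 2"
  shows "2 powr ((1 - (e + c)) * (n * kent q K)) / 2 \<le> real (card (cond_typical q n (e + c) a))"
proof -
  let ?T = "cond_typical q n (e + c) a" and ?M = "Pi_pmf {..<n} undefined (\<lambda>k. K (a k))"
  have "measure ?M {w. \<not> typical q n (e + c) (\<lambda>k. (a k, w k))} \<le> 1 / 2"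
  proof (rule order_trans[OF prob_atypical[OF fin c n] small])
    fix s :: "'a \<times> 'b"
    show "\<bar>(\<Sum>k<n. measure (K (a k)) {b. (a k, b) = s}) - real n * pmf q s\<bar> \<le> e * (real n * pmf q s)"
      using expected_count_kernel[OF _ t, of q "fst s" K "snd s"] K by (simp add: kernel_of_def)
  qed
  moreover have "measure ?M {w. \<not> typical q n (e + c) (\<lambda>k. (a k, w k))}
      = 1 - measure ?M {w. typical q n (e + c) (\<lambda>k. (a k, w k))}"
    by (subst measure_pmf.prob_compl[symmetric]) (auto simp: Compl_eq[symmetric] intro!: arg_cong[where f="measure ?M"])
  \<comment> \<open>Drawn words equal \<open>undefined\<close> outside the block, so the
    extensionality in \<open>cond_typical\<close> removes only null words.\<close>
  moreover have "measure ?M {w. typical q n (e + c) (\<lambda>k. (a k, w k))} = measure ?M ?T"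
    by (intro measure_prob_cong_0) (auto simp: cond_typical_def pmf_Pi)
  ultimately have "1 / 2 \<le> measure ?M ?T" by simp
  also have "\<dots> = (\<Sum>b\<in>?T. pmf ?M b)"
    by (rule measure_measure_pmf_finite[OF finite_cond_typical[OF fin]])
  also have "\<dots> \<le> (\<Sum>b\<in>?T. 2 powr (- (1 - (e + c)) * (n * kent q K)))"
    by (intro sum_mono pmf_kernel_typical_bounds(2)[OF fin K]) (auto simp: cond_typical_def)
  also have "\<dots> = real (card ?T) * 2 powr (- (1 - (e + c)) * (n * kent q K))" by simp
  finally show ?thesis unfolding mult_minus_left powr_minus by (simp add: field_simps)
qed

section \<open>Random labels\<close>

text \<open>Coordinates are independent. On \<open>T\<close> the prescribed value either contradicts
  \<open>B z\<close>, making the event impossible, or meets no restriction and contributes its own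
  probability.\<close>

lemma prob_extra_constraints_le:
  fixes p :: "'z \<Rightarrow> 'c pmf"
  assumes Z: "finite Z" and T: "T \<subseteq> Z" and B: "\<And>z. z \<in> T \<Longrightarrow> c z \<notin> B z \<or> B z = UNIV"
  shows "measure (Pi_pmf Z dflt p) {\<alpha>. (\<forall>z\<in>Z. \<alpha> z \<in> B z) \<and> (\<forall>z\<in>T. \<alpha> z = c z)}
    \<le> measure (Pi_pmf Z dflt p) {\<alpha>. \<forall>z\<in>Z. \<alpha> z \<in> B z} * (\<Prod>z\<in>T. pmf (p z) (c z))"
proof -
  let ?B = "\<lambda>z. B z \<inter> (if z \<in> T then {c z} else UNIV)"
  have "{\<alpha>. (\<forall>z\<in>Z. \<alpha> z \<in> B z) \<and> (\<forall>z\<in>T. \<alpha> z = c z)} = Pi Z ?B"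
    using T by (auto simp: Pi_iff split: if_splits)
  then have "measure (Pi_pmf Z dflt p) {\<alpha>. (\<forall>z\<in>Z. \<alpha> z \<in> B z) \<and> (\<forall>z\<in>T. \<alpha> z = c z)}
      = (\<Prod>z\<in>Z. measure (p z) (?B z))"
    by (simp add: measure_Pi_pmf_Pi[OF Z])
  also have "\<dots> \<le> (\<Prod>z\<in>Z. measure (p z) (B z) * (if z \<in> T then pmf (p z) (c z) else 1))"
  proof (intro prod_mono conjI measure_nonneg)
    fix z assume "z \<in> Z"
    show "measure (p z) (?B z) \<le> measure (p z) (B z) * (if z \<in> T then pmf (p z) (c z) else 1)"
    proof (cases "z \<in> T")
      case True
      then consider "c z \<notin> B z" | "B z = UNIV" using B by blast
      then show ?thesis
      proof cases
        case 1
        then have "?B z = {}" using True by auto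
        then show ?thesis by simp
      next
        case 2
        then show ?thesis using True by (simp add: measure_pmf_single)
      qed
    qed simp
  qed
  also have "\<dots> = measure (Pi_pmf Z dflt p) (Pi Z B) * (\<Prod>z\<in>T. pmf (p z) (c z))"
    using T Z by (simp add: prod.distrib measure_Pi_pmf_Pi[OF Z] prod.If_cases Int_absorb1)
  also have "Pi Z B = {\<alpha>. \<forall>z\<in>Z. \<alpha> z \<in> B z}" by auto
  finally show ?thesis .
qed

text \<open>Every word \<open>v \<in> Q\<close> carries one uniform label below \<open>L S\<close> for each layer \<open>S\<close>.  The words with
  label below \<open>Kb S\<close> form the codebook of the layer, and the label of a codeword is its bin index.
  The encoder runs through the layers in the order \<open>vs\<close> and picks in each the \<open>\<rho>\<close>-least codeword
  among the candidates \<open>G u S\<close>.\<close>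

locale layered_labels =
  fixes vs :: "'s list" and Q :: "'v set" and L Kb :: "'s \<Rightarrow> nat" and \<rho> :: "'v \<Rightarrow> nat"
  assumes distinct: "distinct vs" and finQ: "finite Q" and neQ: "Q \<noteq> {}"
    and inj: "inj_on \<rho> Q" and Kb_pos: "\<And>S. 0 < Kb S" and Kb_le: "\<And>S. Kb S \<le> L S"
begin

section \<open>Sequential selection of codewords\<close>

definition lab :: "('s \<times> 'v \<Rightarrow> nat) pmf" where
  "lab = Pi_pmf (set vs \<times> Q) 0 (\<lambda>z. pmf_of_set {..<L (fst z)})"

definition causal :: "(('s \<Rightarrow> 'v) \<Rightarrow> 's \<Rightarrow> 'v set) \<Rightarrow> bool" where
  "causal G \<longleftrightarrow> (\<forall>u. \<forall>j<length vs. G u (vs ! j) \<subseteq> Q) \<and>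
     (\<forall>u u'. \<forall>j<length vs. (\<forall>i<j. u (vs ! i) = u' (vs ! i)) \<longrightarrow> G u (vs ! j) = G u' (vs ! j))"

text \<open>A run through the first \<open>j\<close> layers, stored in a total function whose
  entries from layer \<open>j\<close> on are arbitrary words. Uniqueness is therefore claimed for
  complete runs only.\<close>

definition sel :: "(('s \<Rightarrow> 'v) \<Rightarrow> 's \<Rightarrow> 'v set) \<Rightarrow> ('s \<times> 'v \<Rightarrow> nat) \<Rightarrow> nat \<Rightarrow> ('s \<Rightarrow> 'v) \<Rightarrow> bool" where
  "sel G \<alpha> j u \<longleftrightarrow> u \<in> PiE (set vs) (\<lambda>_. Q) \<and> (\<forall>i<j. u (vs ! i) \<in> G u (vs ! i) \<and>
     \<alpha> (vs ! i, u (vs ! i)) < Kb (vs ! i) \<and>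
     (\<forall>v\<in>G u (vs ! i). \<rho> v < \<rho> (u (vs ! i)) \<longrightarrow> Kb (vs ! i) \<le> \<alpha> (vs ! i, v)))"

text \<open>Strong induction on the layers: agreement before layer \<open>j\<close> gives equal
  candidate sets by causality, and two rank-least codewords of one set coincide by
  injectivity.\<close>

lemma sel_unique:
  assumes G: "causal G" and u: "sel G \<alpha> (length vs) u" and u': "sel G \<alpha> (length vs) u'"
  shows "u = u'"
proof -
  have "u (vs ! j) = u' (vs ! j)" if "j < length vs" for j
    using that
  proof (induction j rule: less_induct)
    case (less j)
    then have eq: "G u (vs ! j) = G u' (vs ! j)" and sub: "G u (vs ! j) \<subseteq> Q"
      using G unfolding causal_def by (meson less_trans)+
    let ?a = "u (vs ! j)" and ?b = "u' (vs ! j)"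
    have "\<not> \<rho> ?a < \<rho> ?b" "\<not> \<rho> ?b < \<rho> ?a" "?a \<in> Q" "?b \<in> Q"
      using u u' less.prems eq sub unfolding sel_def by (metis leD subsetD)+
    then show ?case using inj by (meson inj_onD linorder_neqE_nat)
  qed
  then have "u S = u' S" if "S \<in> set vs" for S using that by (metis in_set_conv_nth)
  then show ?thesis using u u' unfolding sel_def by (metis PiE_ext)
qed

text \<open>A partial run is extended by the rank-least codeword among the current
  candidates.\<close>

lemma sel_exists:
  assumes G: "causal G"
    and cov: "\<And>u j. j < length vs \<Longrightarrow> sel G \<alpha> j u \<Longrightarrow> \<exists>v\<in>G u (vs ! j). \<alpha> (vs ! j, v) < Kb (vs ! j)"
  shows "\<exists>u. sel G \<alpha> (length vs) u"
proof -
  have "\<exists>u. sel G \<alpha> j u" if "j \<le> length vs" for j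
    using that
  proof (induction j)
    case 0
    obtain v where "v \<in> Q" using neQ by blast
    then show ?case by (intro exI[of _ "\<lambda>S\<in>set vs. v"]) (auto simp: sel_def)
  next
    case (Suc j)
    then obtain u where u: "sel G \<alpha> j u" by auto
    let ?S = "vs ! j"
    have j: "j < length vs" using Suc.prems by simp
    let ?P = "\<lambda>v. v \<in> G u ?S \<and> \<alpha> (?S, v) < Kb ?S"
    obtain v where v: "?P v" and min: "\<And>w. ?P w \<Longrightarrow> \<rho> v \<le> \<rho> w"
      using cov[OF j u] ex_has_least_nat[of ?P _ \<rho>] by blast
    define u' where "u' = u(?S := v)"
    have vQ: "v \<in> Q" using v G j unfolding causal_def by blast
    have same: "u' (vs ! i) = u (vs ! i)" if "i < j" for i
      using that j distinct by (simp add: u'_def nth_eq_iff_index_eq)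
    \<comment> \<open>Overwriting layer \<open>j\<close> is harmless: the candidate sets up to layer
      \<open>j\<close> itself read strictly earlier layers only.\<close>
    have Geq: "G u' (vs ! i) = G u (vs ! i)" if "i \<le> j" for i
    proof -
      have "i < length vs" "\<forall>k<i. u' (vs ! k) = u (vs ! k)" using that j same by auto
      then show ?thesis using G unfolding causal_def by blast
    qed
    have "u' \<in> PiE (set vs) (\<lambda>_. Q)"
      using u vQ j unfolding sel_def u'_def by (auto simp: PiE_iff extensional_def)
    moreover have "u' (vs ! i) \<in> G u' (vs ! i) \<and> \<alpha> (vs ! i, u' (vs ! i)) < Kb (vs ! i) \<and>
        (\<forall>v\<in>G u' (vs ! i). \<rho> v < \<rho> (u' (vs ! i)) \<longrightarrow> Kb (vs ! i) \<le> \<alpha> (vs ! i, v))" if "i < Suc j" for i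
    proof (cases "i = j")
      case True
      have "Kb ?S \<le> \<alpha> (?S, w)" if "w \<in> G u ?S" "\<rho> w < \<rho> v" for w
        using min[of w] that by (meson not_le)
      then show ?thesis using v Geq[of j] True by (auto simp: u'_def)
    next
      case False
      then have "i < j" using that by simp
      then show ?thesis using u Geq[of i] same[of i] unfolding sel_def by auto
    qed
    ultimately show ?case unfolding sel_def by blast
  qed
  then show ?thesis by blast
qed

section \<open>Probabilities of missing codewords and of confusion\<close>

lemma prob_no_codeword:
  assumes S: "S \<in> set vs" and g: "g \<subseteq> Q"
  shows "measure lab {\<alpha>. \<forall>v\<in>g. Kb S \<le> \<alpha> (S, v)} = (1 - real (Kb S) / real (L S)) ^ card g"
proof -
  let ?B = "\<lambda>z. if fst z = S \<and> snd z \<in> g then {Kb S..} else UNIV"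
  have L: "0 < L S" using Kb_pos[of S] Kb_le[of S] by simp
  have "{\<alpha>. \<forall>v\<in>g. Kb S \<le> \<alpha> (S, v)} = Pi (set vs \<times> Q) ?B"
    using S g by (auto simp: Pi_iff split: if_splits)
  then have "measure lab {\<alpha>. \<forall>v\<in>g. Kb S \<le> \<alpha> (S, v)}
      = (\<Prod>z\<in>set vs \<times> Q. measure (pmf_of_set {..<L (fst z)}) (?B z))"
    using finQ by (simp add: lab_def measure_Pi_pmf_Pi)
  also have "\<dots> = (\<Prod>z\<in>Pair S ` g. measure (pmf_of_set {..<L (fst z)}) (?B z))"
    using S g finQ by (intro prod.mono_neutral_right) auto
  also have "\<dots> = (\<Prod>v\<in>g. measure (pmf_of_set {..<L S}) {Kb S..})"
    by (subst prod.reindex) (auto simp: inj_on_def)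
  also have "measure (pmf_of_set {..<L S}) {Kb S..} = 1 - real (Kb S) / real (L S)"
  proof -
    have "{..<L S} \<inter> {Kb S..} = {Kb S..<L S}" by auto
    then have "measure (pmf_of_set {..<L S}) {Kb S..} = real (L S - Kb S) / real (L S)"
      using L by (subst measure_pmf_of_set) auto
    then show ?thesis using Kb_le[of S] L by (simp add: of_nat_diff diff_divide_distrib)
  qed
  finally show ?thesis by simp
qed

text \<open>The event is split by the outcome of the encoder. Each outcome is a product constraint
  on the labels, so the extra label equalities cost the full factor \<open>1 / real (L S)\<close> in
  every layer of \<open>D\<close>. The outcomes are disjoint, hence conditioning on the selection
  costs nothing.\<close>

lemma prob_confusion_le:
  assumes G: "causal G" and D: "D \<subseteq> set vs"
    and C: "\<And>u. C u \<subseteq> PiE D (\<lambda>_. Q)" "\<And>u u' S. u' \<in> C u \<Longrightarrow> S \<in> D \<Longrightarrow> u' S \<noteq> u S"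
    and N: "\<And>u. real (card (C u)) \<le> N"
  shows "measure lab {\<alpha>. \<exists>u. sel G \<alpha> (length vs) u \<and> (\<exists>u'\<in>C u. \<forall>S\<in>D. \<alpha> (S, u' S) = \<alpha> (S, u S))}
    \<le> N * (\<Prod>S\<in>D. 1 / real (L S))"
proof -
  let ?Z = "set vs \<times> Q"
  \<comment> \<open>Outcomes are pairs of the chosen words and their labels.\<close>
  let ?W = "PiE (set vs) (\<lambda>_. Q) \<times> PiE (set vs) (\<lambda>S. {..<Kb S})"
  \<comment> \<open>What an outcome reveals about one label: its value at the chosen word, that it
    is no codeword label at a candidate of smaller rank, and nothing elsewhere.\<close>
  let ?B = "\<lambda>w z. (if snd z = fst w (fst z) then {snd w (fst z)}
      else if snd z \<in> G (fst w) (fst z) \<and> \<rho> (snd z) < \<rho> (fst w (fst z)) then {Kb (fst z)..} else UNIV)"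
  let ?E = "\<lambda>w. {\<alpha>. fst w \<in> {u. \<forall>S\<in>set vs. u S \<in> G u S} \<and> (\<forall>z\<in>?Z. \<alpha> z \<in> ?B w z)}"
  let ?F = "\<lambda>w u'. {\<alpha>. \<alpha> \<in> ?E w \<and> (\<forall>z\<in>(\<lambda>S. (S, u' S)) ` D. \<alpha> z = snd w (fst z))}"
  let ?P = "\<Prod>S\<in>D. 1 / real (L S)"
  have finW: "finite ?W" using finQ by (auto intro: finite_PiE)
  have finD: "finite D" using D finite_subset by blast
  have finC: "finite (C u)" for u
    using finQ finD by (intro finite_subset[OF C(1)] finite_PiE) auto
  have L: "0 < L S" for S using Kb_pos[of S] Kb_le[of S] by simp
  have GQ: "G u S \<subseteq> Q" if "S \<in> set vs" for u S
    using G that unfolding causal_def by (metis in_set_conv_nth)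
  have E_sel: "sel G \<alpha> (length vs) (fst w) \<and> snd w = (\<lambda>S\<in>set vs. \<alpha> (S, fst w S))"
    if "w \<in> ?W" "\<alpha> \<in> ?E w" for w \<alpha>
  proof -
    have 1: "\<alpha> (S, fst w S) = snd w S" if S: "S \<in> set vs" for S
    proof -
      have "(S, fst w S) \<in> ?Z" using S \<open>w \<in> ?W\<close> by (auto simp: PiE_iff)
      with \<open>\<alpha> \<in> ?E w\<close> have "\<alpha> (S, fst w S) \<in> ?B w (S, fst w S)" by blast
      then show ?thesis by simp
    qed
    have 2: "Kb S \<le> \<alpha> (S, v)" if S: "S \<in> set vs" "v \<in> G (fst w) S" "\<rho> v < \<rho> (fst w S)" for S v
    proof -
      have "(S, v) \<in> ?Z" using S GQ by auto
      with \<open>\<alpha> \<in> ?E w\<close> have "\<alpha> (S, v) \<in> ?B w (S, v)" by blast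
      moreover have "v \<noteq> fst w S" using S by auto
      ultimately show ?thesis using S by simp
    qed
    have "\<alpha> (S, fst w S) < Kb S" if "S \<in> set vs" for S
      using 1[OF that] that \<open>w \<in> ?W\<close> by (auto simp: PiE_iff)
    moreover have "snd w = (\<lambda>S\<in>set vs. \<alpha> (S, fst w S))"
      using 1 \<open>w \<in> ?W\<close> by (auto simp: PiE_iff extensional_def fun_eq_iff)
    ultimately show ?thesis using 2 \<open>w \<in> ?W\<close> \<open>\<alpha> \<in> ?E w\<close> unfolding sel_def by auto
  qed
  \<comment> \<open>A label assignment determines the complete run, and both together determine the
    recorded labels.\<close>
  have disj: "disjoint_family_on ?E ?W"
    unfolding disjoint_family_on_def
  proof (intro ballI impI)
    fix w w' assume w: "w \<in> ?W" "w' \<in> ?W" "w \<noteq> w'"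
    show "?E w \<inter> ?E w' = {}"
    proof (rule ccontr)
      assume "?E w \<inter> ?E w' \<noteq> {}"
      then obtain \<alpha> where a: "\<alpha> \<in> ?E w" "\<alpha> \<in> ?E w'" by blast
      have "fst w = fst w'" using E_sel[OF w(1) a(1)] E_sel[OF w(2) a(2)] sel_unique[OF G] by blast
      moreover have "snd w = snd w'"
        using E_sel[OF w(1) a(1)] E_sel[OF w(2) a(2)] calculation by simp
      ultimately show False using w(3) prod_eqI by blast
    qed
  qed
  have F_le: "measure lab (?F w u') \<le> measure lab (?E w) * ?P" if w: "w \<in> ?W" and u': "u' \<in> C (fst w)" for w u'
  proof (cases "fst w \<in> {u. \<forall>S\<in>set vs. u S \<in> G u S}")
    case True
    have T: "(\<lambda>S. (S, u' S)) ` D \<subseteq> ?Z" using D C(1) u' by (auto simp: PiE_iff)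
    \<comment> \<open>Since \<open>u'\<close> avoids the chosen word on \<open>D\<close>, its label
      is either free or known to be at least \<open>Kb\<close>, whereas the required label is below
      \<open>Kb\<close>.\<close>
    have ok: "snd w (fst z) \<notin> ?B w z \<or> ?B w z = UNIV" if z: "z \<in> (\<lambda>S. (S, u' S)) ` D" for z
    proof -
      obtain S where S: "S \<in> D" "z = (S, u' S)" using z by blast
      have "snd z \<noteq> fst w (fst z)" using C(2)[OF u' S(1)] S(2) by simp
      moreover have "snd w (fst z) < Kb (fst z)" using w S D by (auto simp: PiE_iff)
      ultimately show ?thesis by (auto simp: not_le)
    qed
    have "measure lab {\<alpha>. (\<forall>z\<in>?Z. \<alpha> z \<in> ?B w z) \<and> (\<forall>z\<in>(\<lambda>S. (S, u' S)) ` D. \<alpha> z = snd w (fst z))}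
       \<le> measure lab {\<alpha>. \<forall>z\<in>?Z. \<alpha> z \<in> ?B w z} *
         (\<Prod>z\<in>(\<lambda>S. (S, u' S)) ` D. pmf (pmf_of_set {..<L (fst z)}) (snd w (fst z)))"
      unfolding lab_def using finQ by (intro prob_extra_constraints_le T ok) auto
    also have "(\<Prod>z\<in>(\<lambda>S. (S, u' S)) ` D. pmf (pmf_of_set {..<L (fst z)}) (snd w (fst z)))
        = (\<Prod>S\<in>D. pmf (pmf_of_set {..<L S}) (snd w S))"
      by (subst prod.reindex) (auto simp: inj_on_def)
    also have "\<dots> = ?P"
    proof (rule prod.cong[OF refl])
      fix S assume "S \<in> D"
      then have "snd w S < Kb S" using w D by (auto simp: PiE_iff)
      then have "snd w S \<in> {..<L S}" using Kb_le[of S] by simp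
      then show "pmf (pmf_of_set {..<L S}) (snd w S) = 1 / real (L S)"
        using L[of S] by (subst pmf_of_set) auto
    qed
    finally show ?thesis using True by simp
  next
    case False
    then have "?F w u' = {}" "?E w = {}" by auto
    then show ?thesis by (simp only: measure_empty mult_zero_left order_refl)
  qed
  have "{\<alpha>. \<exists>u. sel G \<alpha> (length vs) u \<and> (\<exists>u'\<in>C u. \<forall>S\<in>D. \<alpha> (S, u' S) = \<alpha> (S, u S))}
      \<subseteq> (\<Union>w\<in>?W. \<Union>u'\<in>C (fst w). ?F w u')"
  proof safe
    fix \<alpha> u u' assume u: "sel G \<alpha> (length vs) u" and u': "u' \<in> C u" "\<forall>S\<in>D. \<alpha> (S, u' S) = \<alpha> (S, u S)"
    define w where "w = (u, \<lambda>S\<in>set vs. \<alpha> (S, u S))"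
    have s: "u S \<in> G u S \<and> \<alpha> (S, u S) < Kb S \<and> (\<forall>v\<in>G u S. \<rho> v < \<rho> (u S) \<longrightarrow> Kb S \<le> \<alpha> (S, v))"
      if "S \<in> set vs" for S
      using u that unfolding sel_def by (metis in_set_conv_nth)
    have "w \<in> ?W" using u s unfolding w_def sel_def by auto
    moreover have "\<alpha> \<in> ?F w u'" using s u'(2) D unfolding w_def by auto
    moreover have "u' \<in> C (fst w)" using u' by (simp add: w_def)
    ultimately show "\<alpha> \<in> (\<Union>w\<in>?W. \<Union>u'\<in>C (fst w). ?F w u')" by blast
  qed
  then have "measure lab {\<alpha>. \<exists>u. sel G \<alpha> (length vs) u \<and> (\<exists>u'\<in>C u. \<forall>S\<in>D. \<alpha> (S, u' S) = \<alpha> (S, u S))}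
      \<le> measure lab (\<Union>w\<in>?W. \<Union>u'\<in>C (fst w). ?F w u')"
    by (intro measure_pmf.finite_measure_mono) auto
  also have "\<dots> \<le> (\<Sum>w\<in>?W. measure lab (\<Union>u'\<in>C (fst w). ?F w u'))"
    by (intro measure_pmf.finite_measure_subadditive_finite finW) auto
  also have "\<dots> \<le> (\<Sum>w\<in>?W. \<Sum>u'\<in>C (fst w). measure lab (?F w u'))"
    by (intro sum_mono measure_pmf.finite_measure_subadditive_finite finC) auto
  also have "\<dots> \<le> (\<Sum>w\<in>?W. \<Sum>u'\<in>C (fst w). measure lab (?E w) * ?P)"
    by (intro sum_mono F_le)
  also have "\<dots> = (\<Sum>w\<in>?W. real (card (C (fst w))) * (measure lab (?E w) * ?P))" by simp
  also have "\<dots> \<le> (\<Sum>w\<in>?W. N * (measure lab (?E w) * ?P))"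
    by (intro sum_mono mult_right_mono N) (auto intro!: mult_nonneg_nonneg prod_nonneg)
  also have "\<dots> = (\<Sum>w\<in>?W. measure lab (?E w)) * (N * ?P)"
    by (subst sum_distrib_right) (simp add: mult_ac)
  also have "(\<Sum>w\<in>?W. measure lab (?E w)) = measure lab (\<Union>w\<in>?W. ?E w)"
    by (intro measure_pmf.finite_measure_finite_Union[symmetric] finW disj) auto
  \<comment> \<open>Instantiating \<open>N\<close> at an arbitrary argument shows that the bound is
    nonnegative.\<close>
  also have "measure lab (\<Union>w\<in>?W. ?E w) * (N * ?P) \<le> 1 * (N * ?P)"
    using N[of undefined] by (intro mult_right_mono) (auto intro!: mult_nonneg_nonneg prod_nonneg)
  finally show ?thesis by simp
qed

end

section \<open>Averaging\<close>

lemma prob_bind_pmf: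
  fixes K :: "'a \<Rightarrow> 'b pmf"
  shows "measure (bind_pmf A K) S = measure_pmf.expectation A (\<lambda>a. measure (K a) S)"
  unfolding measure_pmf_bind
  by (rule measure_pmf.measure_bind[where N="count_space UNIV"]) (auto simp: measurable_def space_subprob_algebra prob_space_imp_subprob_space measure_pmf.prob_space_axioms)

lemma integrable_prob_kernel: "integrable (measure_pmf A) (\<lambda>a. measure (measure_pmf (K a)) S)"
  by (rule measure_pmf.integrable_const_bound[where B=1]) auto

lemma prob_bind_le:
  fixes K :: "'a \<Rightarrow> 'b pmf"
  assumes "\<And>a. a \<in> set_pmf A \<Longrightarrow> measure (K a) S \<le> \<gamma>"
  shows "measure (bind_pmf A K) S \<le> \<gamma>"
proof -
  have "measure_pmf.expectation A (\<lambda>a. measure (K a) S) \<le> measure_pmf.expectation A (\<lambda>_. \<gamma>)"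
    by (intro integral_mono_AE integrable_prob_kernel) (auto simp: AE_measure_pmf_iff assms)
  then show ?thesis by (simp add: prob_bind_pmf)
qed

text \<open>An average cannot lie strictly below every one of its values.\<close>

lemma prob_bind_witness:
  fixes K :: "'a \<Rightarrow> 'b pmf"
  shows "\<exists>a\<in>set_pmf A. measure (K a) S \<le> measure (bind_pmf A K) S"
proof (rule ccontr)
  assume "\<not> ?thesis"
  then have "AE a in measure_pmf A. measure (bind_pmf A K) S < measure (K a) S"
    by (auto simp: AE_measure_pmf_iff not_le)
  then have "measure_pmf.expectation A (\<lambda>_. measure (bind_pmf A K) S)
      < measure_pmf.expectation A (\<lambda>a. measure (K a) S)"
    by (intro measure_pmf.integral_less_AE_space integrable_prob_kernel) auto
  then show False by (simp add: prob_bind_pmf)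
qed

lemma pair_pmf_eq_bind: "pair_pmf A B = bind_pmf A (\<lambda>a. map_pmf (Pair a) B)"
  by (simp add: pair_pmf_def map_pmf_def)

lemma prob_pair_le_left:
  fixes B :: "'b pmf"
  assumes "\<And>a. measure B {b. (a, b) \<in> S} \<le> \<gamma>"
  shows "measure (pair_pmf A B) S \<le> \<gamma>"
  unfolding pair_pmf_eq_bind using assms by (intro prob_bind_le) (simp add: vimage_def)

lemma prob_pair_le_right:
  fixes A :: "'a pmf"
  assumes "\<And>b. measure A {a. (a, b) \<in> S} \<le> \<gamma>"
  shows "measure (pair_pmf A B) S \<le> \<gamma>"
proof -
  have "pair_pmf A B = bind_pmf B (\<lambda>b. map_pmf (\<lambda>a. (a, b)) A)"
    unfolding pair_pmf_def map_pmf_def by (rule bind_commute_pmf)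
  then show ?thesis using assms by (auto intro!: prob_bind_le simp: vimage_def)
qed

lemma prob_pair_witness:
  fixes B :: "'b pmf"
  shows "\<exists>a. measure B {b. (a, b) \<in> S} \<le> measure (pair_pmf A B) S"
  using prob_bind_witness[of A "\<lambda>a. map_pmf (Pair a) B" S]
  unfolding pair_pmf_eq_bind by (auto simp: vimage_def)

text \<open>Two-stage sampling: the first component by its marginal, then the second by the kernel.
  It lets the source word be fixed before the side information is drawn.\<close>

lemma kernel_of_bind:
  assumes "kernel_of q K"
  shows "q = bind_pmf (map_pmf fst q) (\<lambda>a. map_pmf (Pair a) (K a))"
proof (rule pmf_eqI)
  fix s :: "'a \<times> 'b"
  obtain a b where s: "s = (a, b)" by (cases s)
  have "pmf (map_pmf (Pair a') (K a')) (a, b) = pmf (K a) b * indicator {a} a'" for a'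
  proof (cases "a' = a")
    case True
    then have "Pair a' -` {(a, b)} = {b}" by auto
    then show ?thesis using True by (simp add: pmf_map measure_pmf_single)
  next
    case False
    then have "Pair a' -` {(a, b)} = {}" by auto
    then show ?thesis using False by (simp add: pmf_map)
  qed
  then have "pmf (bind_pmf (map_pmf fst q) (\<lambda>a. map_pmf (Pair a) (K a))) (a, b)
      = measure_pmf.expectation (map_pmf fst q) (\<lambda>a'. pmf (K a) b * indicator {a} a')"
    by (simp only: pmf_bind)
  also have "\<dots> = pmf (K a) b * measure (map_pmf fst q) {a}"
    by (simp only: integral_mult_right_zero integral_indicator) simp
  also have "\<dots> = pmf q (a, b)"
    using assms by (simp only: measure_pmf_single kernel_of_def mult.commute)
  finally show "pmf q s = pmf (bind_pmf (map_pmf fst q) (\<lambda>a. map_pmf (Pair a) (K a))) s"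
    by (simp only: s)
qed

section \<open>The coding scheme\<close>

locale scheme =
  fixes p :: "(('m::finite set \<Rightarrow> nat) \<times> 'x::finite \<times> ('m \<Rightarrow> 'y::finite)) pmf"
    and vs :: "'m set list" and c :: real and n :: nat and Kb L :: "'m set \<Rightarrow> nat"
  assumes fin: "finite (set_pmf p)" and vs: "vs \<in> orderings" and c: "c > 0" and n: "n > 0"
    and Kb_pos: "\<And>S. 0 < Kb S" and Kb_le: "\<And>S. Kb S \<le> L S"
    and mk: "markov p (\<lambda>w. restrict (fst w) nesubs) (\<lambda>w. fst (snd w)) (\<lambda>w. snd (snd w))"
begin

abbreviation J :: nat where "J \<equiv> length vs"

text \<open>The pair of \<open>X\<close> and the auxiliaries preceding layer \<open>j\<close>; at
  \<open>j = J\<close> it contains all of them.\<close>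

definition past :: "nat \<Rightarrow> ('m set \<Rightarrow> nat) \<times> 'x \<times> ('m \<Rightarrow> 'y) \<Rightarrow> 'x \<times> ('m set \<Rightarrow> nat)" where
  "past j w = (fst (snd w), restrict (fst w) (set (take j vs)))"

definition pastseq :: "nat \<Rightarrow> (nat \<Rightarrow> 'x) \<Rightarrow> ('m set \<Rightarrow> nat \<Rightarrow> nat) \<Rightarrow> nat \<Rightarrow> 'x \<times> ('m set \<Rightarrow> nat)" where
  "pastseq j x u k = (x k, restrict (\<lambda>S. u S k) (set (take j vs)))"

definition stepdist :: "nat \<Rightarrow> (('x \<times> ('m set \<Rightarrow> nat)) \<times> nat) pmf" where
  "stepdist j = map_pmf (\<lambda>w. (past j w, fst w (vs ! j))) p"

definition fulldist :: "(('x \<times> ('m set \<Rightarrow> nat)) \<times> ('m \<Rightarrow> 'y)) pmf" where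
  "fulldist = map_pmf (\<lambda>w. (past J w, snd (snd w))) p"

text \<open>Typicality radius before layer \<open>j\<close>. The source word, each layer and finally
  the side information add \<open>c\<close> each, ending at \<open>lev (Suc J)\<close>.\<close>

definition lev :: "nat \<Rightarrow> real" where "lev j = (real j + 1) * c"

text \<open>One finite alphabet shared by all layers, so that every layer draws on the same set of
  words.\<close>

definition alph :: "nat set" where "alph = (\<Union>w\<in>set_pmf p. fst w ` nesubs)"

definition words :: "(nat \<Rightarrow> nat) set" where "words = PiE {..<n} (\<lambda>_. alph)"

definition rank :: "(nat \<Rightarrow> nat) \<Rightarrow> nat" where "rank = (SOME \<rho>. inj_on \<rho> words)"

definition idx :: "'m set \<Rightarrow> nat" where "idx S = length (takeWhile (\<lambda>T. T \<noteq> S) vs)"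

definition cand :: "(nat \<Rightarrow> 'x) \<Rightarrow> ('m set \<Rightarrow> nat \<Rightarrow> nat) \<Rightarrow> 'm set \<Rightarrow> (nat \<Rightarrow> nat) set" where
  "cand x u S = cond_typical (stepdist (idx S)) n (lev (idx S) + c) (pastseq (idx S) x u)"

lemma distinct_vs: "distinct vs" and set_vs: "set vs = nesubs"
  using vs by (auto simp: orderings_def)

lemma finite_alph: "finite alph"
  unfolding alph_def using fin by auto

lemma words_ne: "words \<noteq> {}"
proof -
  have "(UNIV :: 'm set) \<in> nesubs" by (simp add: nesubs_def)
  then have "alph \<noteq> {}" unfolding alph_def using set_pmf_not_empty[of p] by blast
  then show ?thesis by (simp add: words_def PiE_eq_empty_iff)
qed

lemma finite_words: "finite words"
  unfolding words_def using finite_alph by (auto intro: finite_PiE)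

lemma rank_inj: "inj_on rank words"
  unfolding rank_def using finite_imp_inj_to_nat_seg[OF finite_words] by (metis someI_ex)

sublocale layered_labels vs words L Kb rank
  by unfold_locales (use distinct_vs finite_words words_ne rank_inj Kb_pos Kb_le in auto)

lemma idx_nth: "j < J \<Longrightarrow> idx (vs ! j) = j"
proof -
  assume j: "j < J"
  have "takeWhile (\<lambda>T. T \<noteq> vs ! j) vs = take j vs"
    by (rule takeWhile_eq_take_P_nth) (use j distinct_vs in \<open>auto simp: nth_eq_iff_index_eq\<close>)
  then show ?thesis using j by (simp add: idx_def)
qed

lemma nth_nesubs: "j < J \<Longrightarrow> vs ! j \<in> nesubs"
  using set_vs nth_mem by blast

lemma fin_map: "finite (set_pmf (map_pmf f p))"
  using fin by simp

lemma fin_stepdist: "finite (set_pmf (stepdist j))"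
  unfolding stepdist_def by (rule fin_map)

section \<open>Covering: the encoder finds a codeword in every layer\<close>

lemma causal_cand: "causal (cand x)"
  unfolding causal_def
proof (intro conjI allI impI)
  fix u j assume j: "j < J"
  have "snd ` set_pmf (stepdist j) \<subseteq> alph"
    using nth_nesubs[OF j] by (auto simp: stepdist_def alph_def)
  then show "cand x u (vs ! j) \<subseteq> words"
    unfolding cand_def idx_nth[OF j] words_def
    by (intro order_trans[OF cond_typical_subset] PiE_mono) auto
next
  fix u u' :: "'m set \<Rightarrow> nat \<Rightarrow> nat" and j
  assume j: "j < J" and eq: "\<forall>i<j. u (vs ! i) = u' (vs ! i)"
  have "u S = u' S" if "S \<in> set (take j vs)" for S
    using that eq j by (auto simp: in_set_conv_nth)
  then have "pastseq j x u = pastseq j x u'"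
    by (auto simp: pastseq_def fun_eq_iff restrict_def)
  then show "cand x u (vs ! j) = cand x u' (vs ! j)"
    unfolding cand_def idx_nth[OF j] by simp
qed

text \<open>The chosen word is jointly typical with the past at radius \<open>lev j + c\<close>;
  inserting it into the tuple is a deterministic map and keeps that radius.\<close>

lemma typical_past_Suc:
  assumes j: "j < J" and t: "u (vs ! j) \<in> cand x u (vs ! j)"
  shows "typical (map_pmf (past (Suc j)) p) n (lev (Suc j)) (pastseq (Suc j) x u)"
proof -
  define h :: "('x \<times> ('m set \<Rightarrow> nat)) \<times> nat \<Rightarrow> 'x \<times> ('m set \<Rightarrow> nat)" where
    "h = (\<lambda>((x, r), v). (x, restrict (r(vs ! j := v)) (set (take (Suc j) vs))))"
  have tk: "set (take (Suc j) vs) = insert (vs ! j) (set (take j vs))"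
    using j by (simp add: take_Suc_conv_app_nth)
  have "lev j + c = lev (Suc j)" by (simp add: lev_def algebra_simps)
  then have "typical (stepdist j) n (lev (Suc j)) (\<lambda>k. (pastseq j x u k, u (vs ! j) k))"
    using t unfolding cand_def idx_nth[OF j] cond_typical_def by simp
  from typical_map[OF fin_stepdist this, of h]
  have "typical (map_pmf h (stepdist j)) n (lev (Suc j)) (\<lambda>k. h (pastseq j x u k, u (vs ! j) k))" .
  moreover have "(\<lambda>k. h (pastseq j x u k, u (vs ! j) k)) = pastseq (Suc j) x u"
    unfolding h_def pastseq_def tk by (auto simp: fun_eq_iff restrict_def)
  moreover have "(\<lambda>w. h (past j w, fst w (vs ! j))) = past (Suc j)"
    unfolding h_def past_def tk by (auto simp: fun_eq_iff restrict_def)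
  ultimately show ?thesis unfolding stepdist_def map_pmf_comp by simp
qed

text \<open>Before layer 0 no auxiliary has been read, so the tuple component is constant, the
  argument \<open>undefined\<close> is a dummy, and this is typicality of \<open>x\<close>
  alone.\<close>

abbreviation xtyp :: "(nat \<Rightarrow> 'x) \<Rightarrow> bool" where
  "xtyp x \<equiv> typical (map_pmf (past 0) p) n (lev 0) (pastseq 0 x undefined)"

lemma typical_past_sel:
  assumes "xtyp x" "j \<le> J" "sel (cand x) \<alpha> j u"
  shows "typical (map_pmf (past j) p) n (lev j) (pastseq j x u)"
proof (cases j)
  case 0
  have "pastseq 0 x u = pastseq 0 x undefined" by (simp add: pastseq_def fun_eq_iff)
  then show ?thesis using assms(1) 0 by simp
next
  case (Suc i)
  then show ?thesis using typical_past_Suc[of i u x] assms(2,3) unfolding sel_def by auto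
qed

text \<open>Ranging over all typical pasts, whether or not they arise from a selection, keeps the
  candidate sets independent of the labels in the union bound.\<close>

definition noncovering :: "('m set \<times> (nat \<Rightarrow> nat) \<Rightarrow> nat) set" where
  "noncovering = {\<alpha>. \<exists>x\<in>PiE {..<n} (\<lambda>_. UNIV). \<exists>u\<in>PiE nesubs (\<lambda>_. words). \<exists>j<J.
     typical (map_pmf (past j) p) n (lev j) (pastseq j x u) \<and>
     (\<forall>v\<in>cand x u (vs ! j). Kb (vs ! j) \<le> \<alpha> (vs ! j, v))}"

lemma sel_exists_if_covering:
  assumes "\<alpha> \<notin> noncovering" "xtyp x" "x \<in> PiE {..<n} (\<lambda>_. UNIV)"
  shows "\<exists>u. sel (cand x) \<alpha> J u"
proof (rule sel_exists[OF causal_cand])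
  fix u j assume j: "j < J" and u: "sel (cand x) \<alpha> j u"
  then have "typical (map_pmf (past j) p) n (lev j) (pastseq j x u)"
    using typical_past_sel[OF assms(2)] by simp
  moreover have "u \<in> PiE nesubs (\<lambda>_. words)" using u set_vs by (simp add: sel_def)
  ultimately show "\<exists>v\<in>cand x u (vs ! j). \<alpha> (vs ! j, v) < Kb (vs ! j)"
    using assms(1,3) j unfolding noncovering_def by (auto simp: not_le)
qed

text \<open>The triples of source word, choices and layer are only exponentially many in
  \<open>n\<close>, to be beaten by a doubly exponentially small \<open>\<gamma>\<close>.\<close>

lemma prob_noncovering_le:
  assumes \<gamma>: "\<And>x u j. j < J \<Longrightarrow> typical (map_pmf (past j) p) n (lev j) (pastseq j x u) \<Longrightarrow>
      (1 - real (Kb (vs ! j)) / real (L (vs ! j))) ^ card (cand x u (vs ! j)) \<le> \<gamma>" and "\<gamma> \<ge> 0"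
  shows "measure lab noncovering \<le> real J * (real (CARD('x)) * real (card alph) ^ card (nesubs :: 'm set set)) ^ n * \<gamma>"
proof -
  let ?X = "PiE {..<n} (\<lambda>_. UNIV :: 'x set)" and ?U = "PiE (nesubs :: 'm set set) (\<lambda>_. words)"
  let ?B = "\<lambda>(x, u, j). {\<alpha>. typical (map_pmf (past j) p) n (lev j) (pastseq j x u) \<and>
     (\<forall>v\<in>cand x u (vs ! j). Kb (vs ! j) \<le> \<alpha> (vs ! j, v))}"
  let ?I = "?X \<times> ?U \<times> {..<J}"
  have finI: "finite ?I" using finite_words by (intro finite_cartesian_product finite_PiE) auto
  have "noncovering = (\<Union>i\<in>?I. ?B i)" unfolding noncovering_def by auto
  then have "measure lab noncovering \<le> (\<Sum>i\<in>?I. measure lab (?B i))"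
    using measure_pmf.finite_measure_subadditive_finite[OF finI, of ?B lab] by simp
  also have "\<dots> \<le> (\<Sum>i\<in>?I. \<gamma>)"
  proof (rule sum_mono)
    fix i assume "i \<in> ?I"
    then obtain x u j where i: "i = (x, u, j)" "j < J" by auto
    show "measure lab (?B i) \<le> \<gamma>"
    proof (cases "typical (map_pmf (past j) p) n (lev j) (pastseq j x u)")
      case True
      have "cand x u (vs ! j) \<subseteq> words" using causal_cand i(2) unfolding causal_def by blast
      then show ?thesis
        using prob_no_codeword[of "vs ! j" "cand x u (vs ! j)"] \<gamma>[OF i(2) True] i nth_mem[OF i(2)] True
        by simp
    qed (use \<open>\<gamma> \<ge> 0\<close> i in simp)
  qed
  also have "\<dots> = real (card ?I) * \<gamma>" by simp
  also have "card ?I = CARD('x) ^ n * ((card alph ^ n) ^ card (nesubs :: 'm set set) * J)"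
    by (simp add: card_cartesian_product card_PiE words_def)
  also have "real \<dots> * \<gamma> = real J * (real (CARD('x)) * real (card alph) ^ card (nesubs :: 'm set set)) ^ n * \<gamma>"
    by (simp add: power_mult_distrib power_mult[symmetric] mult_ac)
  finally show ?thesis .
qed

section \<open>Confusable tuples\<close>

definition conf :: "'m \<Rightarrow> 'm set set \<Rightarrow> (nat \<Rightarrow> 'y) \<Rightarrow> ('m set \<Rightarrow> nat \<Rightarrow> nat) \<Rightarrow> ('m set \<Rightarrow> nat \<Rightarrow> nat) set" where
  "conf l D y u = {u'\<in>PiE D (\<lambda>_. words). (\<forall>S\<in>D. u' S \<noteq> u S) \<and>
     typical (map_pmf (\<lambda>w. ((restrict (fst w) (Dset l - D), snd (snd w) l), restrict (fst w) D)) p) n (lev (Suc J))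
       (\<lambda>k. ((restrict (\<lambda>S. u S k) (Dset l - D), y k), restrict (\<lambda>S. u' S k) D))}"

text \<open>A tuple of words is read as a word of tuples, which lies in a conditional typical set
  given the correct layers and the side information.\<close>

lemma card_conf_le:
  "real (card (conf l D y u)) \<le> 2 powr ((1 + lev (Suc J)) * (real n *
     cent p (\<lambda>w. restrict (fst w) D) (\<lambda>w. (restrict (fst w) (Dset l - D), snd (snd w) l))))"
proof -
  let ?q = "map_pmf (\<lambda>w. ((restrict (fst w) (Dset l - D), snd (snd w) l), restrict (fst w) D)) p"
  obtain K where K: "kernel_of ?q K" using kernel_exists by blast
  let ?a = "\<lambda>k. (restrict (\<lambda>S. u S k) (Dset l - D), y k)"
  \<comment> \<open>Transposition, cut off at the block length to match the extensionality of
    \<open>cond_typical\<close>.\<close>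
  let ?h = "\<lambda>u' k. if k < n then restrict (\<lambda>S. u' S k) D else undefined"
  have "card (conf l D y u) \<le> card (cond_typical ?q n (lev (Suc J)) ?a)"
  proof (rule card_inj_on_le[of ?h])
    show "inj_on ?h (conf l D y u)"
    proof (rule inj_onI)
      fix v w assume v: "v \<in> conf l D y u" and w: "w \<in> conf l D y u" and eq: "?h v = ?h w"
      have e: "v S k = w S k" if "S \<in> D" "k < n" for S k
        using fun_cong[OF fun_cong[OF eq, of k], of S] that by simp
      show "v = w"
      proof (rule PiE_ext)
        show "v \<in> PiE D (\<lambda>_. words)" "w \<in> PiE D (\<lambda>_. words)" using v w by (auto simp: conf_def)
        fix S assume S: "S \<in> D"
        then have "v S \<in> words" "w S \<in> words" using v w by (auto simp: conf_def PiE_iff)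
        then show "v S = w S" unfolding words_def by (rule PiE_ext) (use e S in auto)
      qed
    qed
    show "?h ` conf l D y u \<subseteq> cond_typical ?q n (lev (Suc J)) ?a"
    proof safe
      fix u' assume u': "u' \<in> conf l D y u"
      then show "?h u' \<in> cond_typical ?q n (lev (Suc J)) ?a"
        unfolding cond_typical_def conf_def
        by (auto cong: typical_cong)
    qed
    show "finite (cond_typical ?q n (lev (Suc J)) ?a)" by (rule finite_cond_typical[OF fin_map])
  qed
  also have "real (card (cond_typical ?q n (lev (Suc J)) ?a)) \<le> 2 powr ((1 + lev (Suc J)) * (real n * kent ?q K))"
    by (rule card_cond_typical_le[OF fin_map K])
  finally show ?thesis by (simp add: cent_eq_kent[OF fin K])
qed

section \<open>Typicality of the source and of the side information\<close>

definition src :: "(nat \<Rightarrow> 'x \<times> ('m \<Rightarrow> 'y)) pmf" where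
  "src = Pi_pmf {..<n} undefined (\<lambda>_. map_pmf snd p)"

definition xs_of :: "(nat \<Rightarrow> 'x \<times> ('m \<Rightarrow> 'y)) \<Rightarrow> nat \<Rightarrow> 'x" where
  "xs_of w = restrict (\<lambda>k. fst (w k)) {..<n}"

text \<open>For the memoryless source the expected counts are exact, so the starting error is
  \<open>0\<close> and the radius \<open>lev 0 = c\<close> is pure slack.\<close>

lemma prob_source_atypical_le:
  "measure src {w. \<not> xtyp (xs_of w)} \<le> atyp_bound (map_pmf (past 0) p) c n"
proof -
  let ?\<phi> = "\<lambda>k b :: 'x \<times> ('m \<Rightarrow> 'y). (fst b, \<lambda>_ :: 'm set. undefined :: nat)"
  have eq: "xtyp (xs_of w) \<longleftrightarrow> typical (map_pmf (past 0) p) n (0 + c) (\<lambda>k. ?\<phi> k (w k))" for w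
    unfolding lev_def by (simp, intro typical_cong) (simp add: pastseq_def xs_of_def restrict_def)
  have m: "measure (map_pmf snd p) {b. ?\<phi> k b = s} = pmf (map_pmf (past 0) p) s" for k s
    by (simp add: pmf_map past_def vimage_def restrict_def)
  show ?thesis unfolding eq src_def
    by (rule prob_atypical[OF fin_map c n]) (unfold m, simp)
qed

text \<open>By the Markov chain the kernel of the side information given \<open>X\<close> also
  serves given \<open>X\<close> and all auxiliaries. Where \<open>X\<close> has probability zero
  both sides vanish.\<close>

lemma fulldist_kernel:
  assumes K: "kernel_of (map_pmf snd p) K"
  shows "pmf fulldist (s, t) = pmf (map_pmf (past J) p) s * pmf (K (fst s)) t"
proof -
  obtain b a where s: "s = (b, a)" by (cases s)
  let ?A = "\<lambda>w. restrict (fst w) nesubs" and ?B = "\<lambda>w. fst (snd w)" and ?C = "\<lambda>w. snd (snd w)"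
  have past: "past J w = (?B w, ?A w)" for w by (simp add: past_def set_vs)
  have 1: "pmf fulldist (s, t) = pmf (map_pmf (\<lambda>w. (?A w, ?B w, ?C w)) p) (a, b, t)"
    unfolding fulldist_def s pmf_map past by (rule arg_cong[where f="measure p"]) auto
  have 2: "pmf (map_pmf (past J) p) s = pmf (map_pmf (\<lambda>w. (?A w, ?B w)) p) (a, b)"
    unfolding s pmf_map by (rule arg_cong[where f="measure p"]) (auto simp: past)
  have 3: "pmf (map_pmf (\<lambda>w. (?B w, ?C w)) p) (b, t) = pmf (map_pmf ?B p) b * pmf (K b) t"
    using K unfolding kernel_of_def by (simp add: map_pmf_comp)
  have 4: "pmf (map_pmf (\<lambda>w. (?A w, ?B w, ?C w)) p) (a, b, t) * pmf (map_pmf ?B p) b =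
      pmf (map_pmf (\<lambda>w. (?A w, ?B w)) p) (a, b) * pmf (map_pmf (\<lambda>w. (?B w, ?C w)) p) (b, t)"
    using mk unfolding markov_def by blast
  show ?thesis
  proof (cases "pmf (map_pmf ?B p) b = 0")
    case True
    then have "b \<notin> set_pmf (map_pmf ?B p)" unfolding set_pmf_iff by simp
    then have "(a, b, t) \<notin> set_pmf (map_pmf (\<lambda>w. (?A w, ?B w, ?C w)) p)"
      "(a, b) \<notin> set_pmf (map_pmf (\<lambda>w. (?A w, ?B w)) p)" by force+
    then show ?thesis unfolding 1 2 set_pmf_iff by simp
  next
    case False
    with 4 have "pmf fulldist (s, t) = pmf (map_pmf (past J) p) s * pmf (K b) t"
      unfolding 1 2 3 by simp
    then show ?thesis by (simp add: s)
  qed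
qed

definition side_atypical :: "('m set \<times> (nat \<Rightarrow> nat) \<Rightarrow> nat) \<Rightarrow> (nat \<Rightarrow> 'x \<times> ('m \<Rightarrow> 'y)) \<Rightarrow> bool" where
  "side_atypical \<alpha> w \<longleftrightarrow> xtyp (xs_of w) \<and> (\<exists>u. sel (cand (xs_of w)) \<alpha> J u \<and>
     \<not> typical fulldist n (lev (Suc J)) (\<lambda>k. (pastseq J (xs_of w) u k, snd (w k))))"

text \<open>The chosen codewords depend on the source word only, so given the source word the side
  information is memoryless and \<open>U \<leftrightarrow> X \<leftrightarrow> Y\<close> makes the expected joint counts correct.\<close>

lemma prob_side_atypical_le:
  "measure src {w. side_atypical \<alpha> w} \<le> atyp_bound fulldist c n"
proof -
  obtain K where K: "kernel_of (map_pmf snd p) K" using kernel_exists by blast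
  let ?r = "\<lambda>x k. map_pmf (Pair (x k)) (K (x k))"
  \<comment> \<open>The source word is drawn first; the selection depends on it and on
    \<open>\<alpha>\<close> only, hence is fixed in the second stage.\<close>
  have src: "src = bind_pmf (Pi_pmf {..<n} undefined (\<lambda>_. map_pmf fst (map_pmf snd p)))
      (\<lambda>x. Pi_pmf {..<n} undefined (?r x))"
    unfolding src_def by (subst kernel_of_bind[OF K], subst Pi_pmf_bind[where d'=undefined]) auto
  have bnd: "0 \<le> atyp_bound fulldist c n" by (simp add: atyp_bound_def)
  show ?thesis unfolding src
  proof (rule prob_bind_le)
    fix x0 :: "nat \<Rightarrow> 'x"
    let ?M = "Pi_pmf {..<n} undefined (?r x0)"
    define x where "x = restrict x0 {..<n}"
    have fstw: "fst (w k) = x0 k" if "w \<in> set_pmf ?M" "k < n" for w k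
    proof -
      have "w k \<in> set_pmf (?r x0 k)" using that by (simp add: set_Pi_pmf PiE_dflt_def)
      then show ?thesis by auto
    qed
    have xw: "xs_of w = x" if "w \<in> set_pmf ?M" for w
      using fstw[OF that] by (auto simp: xs_of_def x_def restrict_def)
    show "measure ?M {w. side_atypical \<alpha> w} \<le> atyp_bound fulldist c n"
    proof (cases "xtyp x \<and> (\<exists>u. sel (cand x) \<alpha> J u)")
      case False
      then have "\<not> side_atypical \<alpha> w" if "w \<in> set_pmf ?M" for w
        using xw[OF that] by (auto simp: side_atypical_def)
      then have "measure ?M {w. side_atypical \<alpha> w} = 0" by (auto simp: measure_pmf_zero_iff)
      then show ?thesis using bnd by simp
    next
      case True
      then obtain u where u: "sel (cand x) \<alpha> J u" by blast
      let ?ur = "\<lambda>k. restrict (\<lambda>S. u S k) nesubs"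
      let ?\<phi> = "\<lambda>k b. ((fst b, ?ur k), snd b)"
      have t: "typical (map_pmf (past J) p) n (lev J) (pastseq J x u)"
        using typical_past_sel[of x J] True u by blast
      have lev: "lev J + c = lev (Suc J)" by (simp add: lev_def algebra_simps)
      \<comment> \<open>Uniqueness of the complete run replaces the existential by the fixed
        \<open>u\<close>.\<close>
      have "measure ?M {w. side_atypical \<alpha> w} \<le> measure ?M {w. \<not> typical fulldist n (lev J + c) (\<lambda>k. ?\<phi> k (w k))}"
      proof (rule measure_pmf.finite_measure_mono_AE)
        have "\<not> typical fulldist n (lev J + c) (\<lambda>k. ?\<phi> k (w k))" if w: "w \<in> set_pmf ?M" and s: "side_atypical \<alpha> w" for w
        proof -
          have "\<not> typical fulldist n (lev (Suc J)) (\<lambda>k. (pastseq J x u k, snd (w k)))"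
            using s sel_unique[OF causal_cand u] unfolding side_atypical_def xw[OF w] by blast
          moreover have "typical fulldist n (lev (Suc J)) (\<lambda>k. (pastseq J x u k, snd (w k)))
             \<longleftrightarrow> typical fulldist n (lev (Suc J)) (\<lambda>k. ?\<phi> k (w k))"
            using fstw[OF w] by (intro typical_cong) (simp add: pastseq_def x_def set_vs)
          ultimately show ?thesis by (simp add: lev)
        qed
        then show "AE w in ?M. w \<in> {w. side_atypical \<alpha> w} \<longrightarrow> w \<in> {w. \<not> typical fulldist n (lev J + c) (\<lambda>k. ?\<phi> k (w k))}"
          by (auto simp: AE_measure_pmf_iff)
      qed auto
      also have "\<dots> \<le> atyp_bound fulldist c n"
      proof (rule prob_atypical)
        show "finite (set_pmf fulldist)" unfolding fulldist_def by (rule fin_map)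
        fix s :: "('x \<times> ('m set \<Rightarrow> nat)) \<times> ('m \<Rightarrow> 'y)"
        have m: "measure (?r x0 k) {b. ?\<phi> k b = s} = measure (K (fst (pastseq J x u k))) {y. (pastseq J x u k, y) = (fst s, snd s)}"
          if "k < n" for k
          using that by (cases s) (auto simp: vimage_def pastseq_def x_def set_vs intro!: arg_cong[where f="measure (K (x0 k))"])
        have "\<bar>(\<Sum>k<n. measure (K (fst (pastseq J x u k))) {y. (pastseq J x u k, y) = (fst s, snd s)}) - real n * pmf fulldist (fst s, snd s)\<bar>
          \<le> lev J * (real n * pmf fulldist (fst s, snd s))"
          by (rule expected_count_kernel[where K="\<lambda>a. K (fst a)", OF _ t]) (rule fulldist_kernel[OF K])
        then show "\<bar>(\<Sum>k<n. measure (?r x0 k) {b. ?\<phi> k b = s}) - real n * pmf fulldist s\<bar> \<le> lev J * (real n * pmf fulldist s)"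
          using m by simp
      qed (use c n in auto)
      finally show ?thesis .
    qed
  qed
qed

section \<open>Error events and the choice of labels\<close>

definition confused :: "('m set \<times> (nat \<Rightarrow> nat) \<Rightarrow> nat) \<Rightarrow> (nat \<Rightarrow> 'x \<times> ('m \<Rightarrow> 'y)) \<Rightarrow> bool" where
  "confused \<alpha> w \<longleftrightarrow> (\<exists>l D. D \<subseteq> Dset l \<and> D \<noteq> {} \<and> (\<exists>u. sel (cand (xs_of w)) \<alpha> J u \<and>
     (\<exists>u'\<in>conf l D (\<lambda>k. snd (w k) l) u. \<forall>S\<in>D. \<alpha> (S, u' S) = \<alpha> (S, u S))))"

lemma Dset_subset: "Dset l \<subseteq> nesubs"
  by (auto simp: Dset_def nesubs_def)

text \<open>With \<open>w\<close> fixed only the labels are random; a union bound over decoders and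
  sets of wrong layers reduces the claim to \<open>prob_confusion_le\<close>.\<close>

lemma prob_confused_le:
  assumes "\<And>l D. D \<subseteq> Dset l \<Longrightarrow> D \<noteq> {} \<Longrightarrow> 2 powr ((1 + lev (Suc J)) * (real n *
     cent p (\<lambda>w. restrict (fst w) D) (\<lambda>w. (restrict (fst w) (Dset l - D), snd (snd w) l)))) *
     (\<Prod>S\<in>D. 1 / real (L S)) \<le> \<gamma>"
  shows "measure lab {\<alpha>. confused \<alpha> w} \<le> real (card (UNIV :: ('m \<times> 'm set set) set)) * \<gamma>"
proof -
  let ?B = "\<lambda>(l, D). {\<alpha>. D \<subseteq> Dset l \<and> D \<noteq> {} \<and> (\<exists>u. sel (cand (xs_of w)) \<alpha> J u \<and>
     (\<exists>u'\<in>conf l D (\<lambda>k. snd (w k) l) u. \<forall>S\<in>D. \<alpha> (S, u' S) = \<alpha> (S, u S)))}"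
  have le: "measure lab (?B (l, D)) \<le> \<gamma>" if D: "D \<subseteq> Dset l" "D \<noteq> {}" for l D
  proof -
    have "measure lab {\<alpha>. \<exists>u. sel (cand (xs_of w)) \<alpha> J u \<and>
        (\<exists>u'\<in>conf l D (\<lambda>k. snd (w k) l) u. \<forall>S\<in>D. \<alpha> (S, u' S) = \<alpha> (S, u S))}
      \<le> 2 powr ((1 + lev (Suc J)) * (real n *
         cent p (\<lambda>w. restrict (fst w) D) (\<lambda>w. (restrict (fst w) (Dset l - D), snd (snd w) l)))) *
         (\<Prod>S\<in>D. 1 / real (L S))"
      by (rule prob_confusion_le[OF causal_cand _ _ _ card_conf_le])
         (use D Dset_subset[of l] in \<open>auto simp: set_vs conf_def\<close>)
    also have "\<dots> \<le> \<gamma>" by (rule assms[OF D])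
    finally show ?thesis using D by simp
  qed
  obtain l :: 'm where True by simp
  \<comment> \<open>Pairs with inadmissible \<open>D\<close> contribute empty events and need
    \<open>\<gamma>\<close> nonnegative; the admissible case \<open>D = Dset l\<close> supplies
    this.\<close>
  have "0 \<le> \<gamma>" using order_trans[OF measure_nonneg le[of "Dset l" l]] by (auto simp: Dset_def)
  have "{\<alpha>. confused \<alpha> w} = (\<Union>i\<in>UNIV. ?B i)" by (intro set_eqI) (simp add: confused_def)
  then have "measure lab {\<alpha>. confused \<alpha> w} \<le> (\<Sum>i\<in>UNIV. measure lab (?B i))"
    using measure_pmf.finite_measure_subadditive_finite[of UNIV ?B lab] by simp
  also have "\<dots> \<le> (\<Sum>i\<in>(UNIV :: ('m \<times> 'm set set) set). \<gamma>)"
  proof (rule sum_mono)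
    fix i :: "'m \<times> 'm set set"
    obtain l D where i: "i = (l, D)" by (cases i)
    show "measure lab (?B i) \<le> \<gamma>"
    proof (cases "D \<subseteq> Dset l \<and> D \<noteq> {}")
      case True
      then show ?thesis using le[of D l] i by simp
    next
      case False
      then have "?B i = {}" using i by auto
      then show ?thesis using \<open>0 \<le> \<gamma>\<close> by (simp only: measure_empty)
    qed
  qed
  finally show ?thesis by simp
qed

definition bad :: "('m set \<times> (nat \<Rightarrow> nat) \<Rightarrow> nat) \<Rightarrow> (nat \<Rightarrow> 'x \<times> ('m \<Rightarrow> 'y)) set" where
  "bad \<alpha> = {w. \<alpha> \<in> noncovering \<or> \<not> xtyp (xs_of w) \<or> side_atypical \<alpha> w \<or> confused \<alpha> w}"

text \<open>Source and side atypicality are bounded for each label assignment, covering and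
  confusion for each source block. All four bounds pass to the product measure, where one assignment
  does no worse than the average.\<close>

lemma good_labels_exist:
  assumes "measure lab noncovering \<le> \<gamma>1" "\<And>w. measure lab {\<alpha>. confused \<alpha> w} \<le> \<gamma>2"
  shows "\<exists>\<alpha>. measure src (bad \<alpha>) \<le> \<gamma>1 + atyp_bound (map_pmf (past 0) p) c n + atyp_bound fulldist c n + \<gamma>2"
proof -
  let ?M = "pair_pmf lab src"
  let ?B1 = "{(\<alpha>, w). \<alpha> \<in> noncovering}" and ?B2 = "{(\<alpha>, w). \<not> xtyp (xs_of w)}"
    and ?B3 = "{(\<alpha>, w). side_atypical \<alpha> w}" and ?B4 = "{(\<alpha>, w). confused \<alpha> w}"
  have "measure ?M (?B1 \<union> ?B2 \<union> ?B3 \<union> ?B4) \<le> measure ?M ?B1 + measure ?M ?B2 + measure ?M ?B3 + measure ?M ?B4"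
    using measure_Un_le[of "?B1 \<union> ?B2 \<union> ?B3" ?M ?B4] measure_Un_le[of "?B1 \<union> ?B2" ?M ?B3] measure_Un_le[of ?B1 ?M ?B2]
    by simp
  also have "\<dots> \<le> \<gamma>1 + atyp_bound (map_pmf (past 0) p) c n + atyp_bound fulldist c n + \<gamma>2"
    using assms prob_source_atypical_le prob_side_atypical_le
    by (intro add_mono prob_pair_le_right prob_pair_le_left) (simp_all add: split_def)
  finally have "measure ?M (?B1 \<union> ?B2 \<union> ?B3 \<union> ?B4) \<le> \<dots>" .
  moreover obtain \<alpha> where "measure src {w. (\<alpha>, w) \<in> ?B1 \<union> ?B2 \<union> ?B3 \<union> ?B4} \<le> measure ?M (?B1 \<union> ?B2 \<union> ?B3 \<union> ?B4)"
    using prob_pair_witness[of src "?B1 \<union> ?B2 \<union> ?B3 \<union> ?B4" lab] by blast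
  moreover have "{w. (\<alpha>, w) \<in> ?B1 \<union> ?B2 \<union> ?B3 \<union> ?B4} = bad \<alpha>" by (auto simp: bad_def)
  ultimately show ?thesis by (intro exI[of _ \<alpha>]) simp
qed

section \<open>Decoding and the resulting code\<close>

definition decodable :: "('m set \<times> (nat \<Rightarrow> nat) \<Rightarrow> nat) \<Rightarrow> 'm \<Rightarrow> ('m set \<Rightarrow> nat) \<Rightarrow> (nat \<Rightarrow> 'y) \<Rightarrow>
    ('m set \<Rightarrow> nat \<Rightarrow> nat) \<Rightarrow> bool" where
  "decodable \<alpha> l b y v \<longleftrightarrow> v \<in> PiE (Dset l) (\<lambda>_. words) \<and> (\<forall>S\<in>Dset l. \<alpha> (S, v S) = b S) \<and>
     typical (map_pmf (\<lambda>w. (restrict (fst w) (Dset l), snd (snd w) l)) p) n (lev (Suc J))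
       (\<lambda>k. (restrict (\<lambda>S. v S k) (Dset l), y k))"

text \<open>The chosen tuple passes the test of decoder \<open>l\<close> because joint typicality
  projects. Another passing tuple, restricted to the layers where it is wrong, would be
  confusable.\<close>

lemma good_word_decodes:
  assumes w: "w \<notin> bad \<alpha>"
  obtains u where "sel (cand (xs_of w)) \<alpha> J u"
    and "typical fulldist n (lev (Suc J)) (\<lambda>k. (pastseq J (xs_of w) u k, snd (w k)))"
    and "\<forall>l v. decodable \<alpha> l (\<lambda>S\<in>nesubs. \<alpha> (S, u S)) (\<lambda>k. snd (w k) l) v \<longleftrightarrow> v = restrict u (Dset l)"
proof -
  have "xs_of w \<in> PiE {..<n} (\<lambda>_. UNIV)" by (auto simp: xs_of_def)
  then obtain u where u: "sel (cand (xs_of w)) \<alpha> J u"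
    using sel_exists_if_covering[of \<alpha> "xs_of w"] w unfolding bad_def by blast
  then have t: "typical fulldist n (lev (Suc J)) (\<lambda>k. (pastseq J (xs_of w) u k, snd (w k)))"
    using w unfolding bad_def side_atypical_def by blast
  have uQ: "u \<in> PiE nesubs (\<lambda>_. words)" using u set_vs by (simp add: sel_def)
  have "decodable \<alpha> l (\<lambda>S\<in>nesubs. \<alpha> (S, u S)) (\<lambda>k. snd (w k) l) v \<longleftrightarrow> v = restrict u (Dset l)" for l v
  proof
    assume v: "v = restrict u (Dset l)"
    define h :: "('x \<times> ('m set \<Rightarrow> nat)) \<times> ('m \<Rightarrow> 'y) \<Rightarrow> ('m set \<Rightarrow> nat) \<times> 'y"
      where "h = (\<lambda>s. (restrict (snd (fst s)) (Dset l), snd s l))"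
    have rr: "nesubs \<inter> Dset l = Dset l" using Dset_subset[of l] by blast
    have "finite (set_pmf fulldist)" unfolding fulldist_def by (rule fin_map)
    from typical_map[OF this t, of h]
    have "typical (map_pmf (\<lambda>w. (restrict (fst w) (Dset l), snd (snd w) l)) p) n (lev (Suc J))
       (\<lambda>k. (restrict (\<lambda>S. u S k) (Dset l), snd (w k) l))"
      by (simp add: fulldist_def map_pmf_comp h_def past_def pastseq_def set_vs rr)
    moreover have "(\<lambda>k. (restrict (\<lambda>S. v S k) (Dset l), snd (w k) l)) = (\<lambda>k. (restrict (\<lambda>S. u S k) (Dset l), snd (w k) l))"
      unfolding v by (auto simp: restrict_def fun_eq_iff)
    ultimately show "decodable \<alpha> l (\<lambda>S\<in>nesubs. \<alpha> (S, u S)) (\<lambda>k. snd (w k) l) v"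
      using uQ Dset_subset[of l] unfolding decodable_def by (auto simp: v)
  next
    assume v: "decodable \<alpha> l (\<lambda>S\<in>nesubs. \<alpha> (S, u S)) (\<lambda>k. snd (w k) l) v"
    define D where "D = {S\<in>Dset l. v S \<noteq> u S}"
    have DD: "D \<subseteq> Dset l" by (auto simp: D_def)
    have "D = {}"
    proof (rule ccontr)
      assume ne: "D \<noteq> {}"
      define h :: "('m set \<Rightarrow> nat) \<times> 'y \<Rightarrow> (('m set \<Rightarrow> nat) \<times> 'y) \<times> ('m set \<Rightarrow> nat)"
        where "h = (\<lambda>s. ((restrict (fst s) (Dset l - D), snd s), restrict (fst s) D))"
      have rr: "Dset l \<inter> (Dset l - D) = Dset l - D" "Dset l \<inter> D = D" using DD by auto
      have "typical (map_pmf h (map_pmf (\<lambda>w. (restrict (fst w) (Dset l), snd (snd w) l)) p)) n (lev (Suc J))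
          (\<lambda>k. h (restrict (\<lambda>S. v S k) (Dset l), snd (w k) l))"
        by (rule typical_map[OF fin_map]) (use v in \<open>simp add: decodable_def\<close>)
      then have tv: "typical (map_pmf (\<lambda>w. ((restrict (fst w) (Dset l - D), snd (snd w) l), restrict (fst w) D)) p) n (lev (Suc J))
          (\<lambda>k. ((restrict (\<lambda>S. v S k) (Dset l - D), snd (w k) l), restrict (\<lambda>S. v S k) D))"
        by (simp add: map_pmf_comp h_def rr)
      \<comment> \<open>Outside \<open>D\<close> the tuples \<open>v\<close> and \<open>u\<close>
        agree, so the conditioning part may be rewritten with the chosen words.\<close>
      have "(\<lambda>k. ((restrict (\<lambda>S. v S k) (Dset l - D), snd (w k) l), restrict (\<lambda>S. v S k) D)) =
         (\<lambda>k. ((restrict (\<lambda>S. u S k) (Dset l - D), snd (w k) l), restrict (\<lambda>S. restrict v D S k) D))"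
        by (auto simp: restrict_def fun_eq_iff D_def)
      with tv have "restrict v D \<in> conf l D (\<lambda>k. snd (w k) l) u"
        using v DD unfolding conf_def decodable_def by (auto simp: D_def PiE_iff)
      moreover have "\<forall>S\<in>D. \<alpha> (S, restrict v D S) = \<alpha> (S, u S)"
      proof
        fix S assume S: "S \<in> D"
        then have "S \<in> Dset l" "S \<in> nesubs" using DD Dset_subset[of l] by blast+
        then show "\<alpha> (S, restrict v D S) = \<alpha> (S, u S)" using v S unfolding decodable_def by simp
      qed
      ultimately have "confused \<alpha> w" unfolding confused_def using u DD ne by blast
      then show False using w by (simp add: bad_def)
    qed
    then show "v = restrict u (Dset l)"
      using v unfolding decodable_def D_def by (intro PiE_ext[of v "Dset l" "\<lambda>_. UNIV"]) (auto simp: PiE_iff)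
  qed
  then show ?thesis by (intro that[OF u t]) blast
qed

text \<open>The message enumerates the vectors of bin indices. Off the bad set the distortion is a
  typical average of its mean; on the bad set it is at most \<open>dm\<close>.\<close>

lemma code_exists:
  fixes d :: "'m \<Rightarrow> 'x \<Rightarrow> 'z \<Rightarrow> real" and gl :: "'m \<Rightarrow> ('m set \<Rightarrow> nat) \<Rightarrow> 'y \<Rightarrow> 'z"
  assumes gl: "\<And>l u y. gl l u y \<in> Xhat l" and d0: "\<And>l x z. d l x z \<ge> 0"
    and dm: "\<And>l x z. z \<in> Xhat l \<Longrightarrow> d l x z \<le> dm" and bad: "measure src (bad \<alpha>) \<le> \<gamma>"
    and E: "\<And>l. measure_pmf.expectation p (\<lambda>w. d l (fst (snd w)) (gl l (restrict (fst w) (Dset l)) (snd (snd w) l))) \<le> E l"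
  shows "\<exists>f g. is_code (map_pmf snd p) d Xhat n (\<Prod>S\<in>nesubs. Kb S)
    (\<lambda>l. (1 + lev (Suc J)) * E l + dm * \<gamma>) f g"
proof -
  let ?bins = "PiE nesubs (\<lambda>S. {..<Kb S})" and ?M = "\<Prod>S\<in>nesubs. Kb S"
  have "card ?bins = card {1..?M}" by (simp add: card_PiE)
  then obtain h where h: "bij_betw h ?bins {1..?M}"
    using finite_same_card_bij[of ?bins "{1..?M}"] finite_PiE[of nesubs "\<lambda>S. {..<Kb S}"] by auto
  \<comment> \<open>Message 1 is an arbitrary default when no complete run exists, which happens
    only for bad blocks.\<close>
  define f where "f xs = (let x = restrict xs {..<n} in
    if \<exists>u. sel (cand x) \<alpha> J u then h (\<lambda>S\<in>nesubs. \<alpha> (S, (SOME u. sel (cand x) \<alpha> J u) S)) else 1)" for xs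
  define g where "g l i ys k = (let v = (SOME v. decodable \<alpha> l (inv_into ?bins h i) ys v) in
    gl l (restrict (\<lambda>S. v S k) (Dset l)) (ys k))" for l i and ys :: "nat \<Rightarrow> 'y" and k
  have bins: "(\<lambda>S\<in>nesubs. \<alpha> (S, u S)) \<in> ?bins" if "sel (cand x) \<alpha> J u" for x u
  proof (rule restrict_PiE_iff[THEN iffD2], intro ballI)
    fix S :: "'m set" assume "S \<in> nesubs"
    then obtain i where "i < J" "vs ! i = S" using set_vs by (metis in_set_conv_nth)
    then show "\<alpha> (S, u S) \<in> {..<Kb S}" using that unfolding sel_def by auto
  qed
  have M: "1 \<le> ?M" using Kb_pos by (simp add: Suc_le_eq prod_pos)
  have fM: "f xs \<in> {1..?M}" for xs
  proof (cases "\<exists>u. sel (cand (restrict xs {..<n})) \<alpha> J u")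
    case True
    then show ?thesis
      using bij_betwE[OF h] bins[OF someI_ex[OF True]] by (simp add: f_def Let_def)
  next
    case False
    then show ?thesis using M by (auto simp: f_def Let_def)
  qed
  let ?V = "\<lambda>l w. (1 / real n) * (\<Sum>k<n. d l (fst (w k)) (g l (f (\<lambda>k. fst (w k))) (\<lambda>k. snd (w k) l) k))"
  have V_dm: "?V l w \<le> dm" for l w
  proof -
    have "(\<Sum>k<n. d l (fst (w k)) (g l (f (\<lambda>k. fst (w k))) (\<lambda>k. snd (w k) l) k)) \<le> (\<Sum>k<n. dm)"
      by (intro sum_mono dm) (simp add: g_def Let_def gl)
    then show ?thesis using n by (simp add: field_simps)
  qed
  have V_good: "?V l w \<le> (1 + lev (Suc J)) * E l" if w: "w \<notin> bad \<alpha>" for l w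
  proof -
    obtain u where u: "sel (cand (xs_of w)) \<alpha> J u"
      and t: "typical fulldist n (lev (Suc J)) (\<lambda>k. (pastseq J (xs_of w) u k, snd (w k)))"
      and dec: "\<forall>l v. decodable \<alpha> l (\<lambda>S\<in>nesubs. \<alpha> (S, u S)) (\<lambda>k. snd (w k) l) v \<longleftrightarrow> v = restrict u (Dset l)"
      using good_word_decodes[OF w] by blast
    have some: "(SOME u. sel (cand (xs_of w)) \<alpha> J u) = u"
      by (rule some_equality[of "sel (cand (xs_of w)) \<alpha> J", OF u]) (rule sel_unique[OF causal_cand _ u])
    have "f (\<lambda>k. fst (w k)) = h (\<lambda>S\<in>nesubs. \<alpha> (S, u S))"
      using u some unfolding f_def Let_def xs_of_def by auto
    then have "inv_into ?bins h (f (\<lambda>k. fst (w k))) = (\<lambda>S\<in>nesubs. \<alpha> (S, u S))"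
      using inv_into_f_f[OF bij_betw_imp_inj_on[OF h] bins[OF u]] by simp
    then have "(SOME v. decodable \<alpha> l (inv_into ?bins h (f (\<lambda>k. fst (w k)))) (\<lambda>k. snd (w k) l) v) = restrict u (Dset l)"
      using dec by simp
    moreover have "restrict (\<lambda>S. restrict u (Dset l) S k) (Dset l) = restrict (\<lambda>S. u S k) (Dset l)" for k
      by (auto simp: restrict_def)
    ultimately have g: "g l (f (\<lambda>k. fst (w k))) (\<lambda>k. snd (w k) l) k = gl l (restrict (\<lambda>S. u S k) (Dset l)) (snd (w k) l)" for k
      unfolding g_def Let_def by (simp only:)
    define \<psi> where "\<psi> s = d l (fst (fst s)) (gl l (restrict (snd (fst s)) (Dset l)) (snd s l))"
      for s :: "('x \<times> ('m set \<Rightarrow> nat)) \<times> ('m \<Rightarrow> 'y)"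
    have rr: "nesubs \<inter> Dset l = Dset l" using Dset_subset[of l] by blast
    have "(\<Sum>k<n. d l (fst (w k)) (g l (f (\<lambda>k. fst (w k))) (\<lambda>k. snd (w k) l) k))
       = (\<Sum>k<n. \<psi> (pastseq J (xs_of w) u k, snd (w k)))"
      unfolding g by (intro sum.cong) (auto simp: \<psi>_def pastseq_def xs_of_def set_vs rr)
    also have "\<dots> \<le> (1 + lev (Suc J)) * (real n * (\<Sum>s\<in>set_pmf fulldist. pmf fulldist s * \<psi> s))"
    proof -
      have "finite (set_pmf fulldist)" unfolding fulldist_def by (rule fin_map)
      from typical_average[OF this t, of \<psi>] show ?thesis
        by (auto simp: \<psi>_def d0 distrib_right)
    qed
    also have "(\<Sum>s\<in>set_pmf fulldist. pmf fulldist s * \<psi> s) =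
        measure_pmf.expectation p (\<lambda>w. d l (fst (snd w)) (gl l (restrict (fst w) (Dset l)) (snd (snd w) l)))"
      unfolding fulldist_def sum_pmf_map[OF fin]
      by (subst integral_measure_pmf[OF fin]) (auto simp: \<psi>_def past_def set_vs rr mult.commute)
    also have "(1 + lev (Suc J)) * (real n * \<dots>) \<le> (1 + lev (Suc J)) * (real n * E l)"
      using E[of l] c by (intro mult_left_mono) (auto simp: lev_def)
    finally show ?thesis using n by (simp add: field_simps)
  qed
  \<comment> \<open>On the bad set the good-case term is kept as well, so it must be
    nonnegative.\<close>
  have E0: "0 \<le> E l" for l
    by (rule order_trans[OF integral_nonneg_AE E]) (simp add: d0)
  have finsrc: "finite (set_pmf src)"
    unfolding src_def by (subst set_Pi_pmf) (auto intro!: finite_PiE_dflt)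
  have "measure_pmf.expectation src (?V l) \<le> (1 + lev (Suc J)) * E l + dm * \<gamma>" for l
  proof -
    have dm0: "0 \<le> dm" using dm[OF gl] d0 order_trans by blast
    have "measure_pmf.expectation src (?V l)
        \<le> measure_pmf.expectation src (\<lambda>w. (1 + lev (Suc J)) * E l + dm * indicator (bad \<alpha>) w)"
    proof (intro integral_mono_AE integrable_measure_pmf_finite finsrc AE_I2)
      fix w
      have "0 \<le> (1 + lev (Suc J)) * E l" using E0[of l] c by (simp add: lev_def)
      then show "?V l w \<le> (1 + lev (Suc J)) * E l + dm * indicator (bad \<alpha>) w"
        using V_good[of w l] V_dm[of l w] by (cases "w \<in> bad \<alpha>") (simp_all del: mult_1)
    qed
    also have "\<dots> = (1 + lev (Suc J)) * E l + dm * measure src (bad \<alpha>)"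
      by (subst Bochner_Integration.integral_add) (auto intro!: integrable_measure_pmf_finite finsrc)
    also have "\<dots> \<le> (1 + lev (Suc J)) * E l + dm * \<gamma>"
      using bad dm0 by (simp add: mult_left_mono)
    finally show ?thesis .
  qed
  then have "is_code (map_pmf snd p) d Xhat n ?M (\<lambda>l. (1 + lev (Suc J)) * E l + dm * \<gamma>) f g"
    unfolding is_code_def src_def[symmetric] using fM by (auto simp: g_def Let_def gl)
  then show ?thesis by blast
qed

end

section \<open>Choice of the codebook sizes\<close>

lemma nat_ceiling_powr_le:
  assumes "0 \<le> t"
  shows "real (nat \<lceil>2 powr t\<rceil>) \<le> 2 * 2 powr t"
proof -
  have "1 \<le> 2 powr t" using assms by (simp add: ge_one_powr_ge_zero)
  moreover have "0 \<le> \<lceil>2 powr t\<rceil>" using calculation by linarith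
  then have "real (nat \<lceil>2 powr t\<rceil>) \<le> 2 powr t + 1" using of_int_ceiling_le_add_one[of "2 powr t"] by simp
  ultimately show ?thesis by linarith
qed

text \<open>If \<open>Kb < L\<close>, constraint (i) makes the codeword density at least
  \<open>2 powr (n * (2 * \<delta> - Hc)) / 2\<close>. Times the number of candidates this is at
  least \<open>2 powr (n * \<delta>) / 4\<close>, and \<open>1 - q \<le> exp (- q)\<close>
  finishes.\<close>

lemma covering_exponent:
  fixes Kb L m :: nat and n :: nat and r r' H Hc \<delta> lv :: real
  assumes Kb: "Kb = nat \<lceil>2 powr (n * (r + 3 * \<delta>))\<rceil>"
    and L: "L = max Kb (nat \<lceil>2 powr (n * (H - r' + \<delta>))\<rceil>)"
    and H: "H \<le> r + r' + Hc" and lv: "lv * Hc \<le> \<delta>"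
    and m: "2 powr ((1 - lv) * (n * Hc)) / 2 \<le> real m"
  shows "(1 - real Kb / real L) ^ m \<le> exp (- (2 powr (n * \<delta>)) / 4)"
proof -
  have Kb0: "Kb > 0" unfolding Kb by simp
  have Kble: "Kb \<le> L" unfolding L by simp
  show ?thesis
  proof (cases "Kb = L")
    \<comment> \<open>Every label is below \<open>Kb\<close>; \<open>m > 0\<close> makes the power
      of zero vanish.\<close>
    case True
    have "0 < real m" by (rule less_le_trans[OF _ m]) simp
    then show ?thesis using True Kb0 by (simp add: power_0_left)
  next
    case False
    define z where "z = 2 powr (n * (H - r' + \<delta>))"
    have Lz: "L = nat \<lceil>z\<rceil>" using False unfolding L z_def by (simp add: max_def split: if_splits)
    have "L \<ge> 2" using False Kble Kb0 by simp
    \<comment> \<open>Having \<open>z > 1\<close> means that rounding up at most doubles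
      \<open>z\<close>.\<close>
    then have "z > 1" unfolding Lz by linarith
    then have "real L \<le> 2 * z" unfolding Lz by linarith
    have KbR: "2 powr (n * (r + 3 * \<delta>)) \<le> real Kb" unfolding Kb by linarith
    let ?q = "real Kb / real L"
    have q1: "?q \<le> 1" using Kble Kb0 by simp
    have e1: "n * (2 * \<delta> - Hc) \<le> n * (r + 3 * \<delta>) - n * (H - r' + \<delta>)"
    proof -
      have "n * (2 * \<delta> - Hc) \<le> n * ((r + 3 * \<delta>) - (H - r' + \<delta>))"
        using H by (intro mult_left_mono) auto
      then show ?thesis by (simp add: algebra_simps)
    qed
    have "2 powr (n * (2 * \<delta> - Hc)) / 2 \<le> 2 powr (n * (r + 3 * \<delta>) - n * (H - r' + \<delta>)) / 2"
      using e1 by (intro divide_right_mono powr_mono) auto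
    also have "\<dots> = 2 powr (n * (r + 3 * \<delta>)) / (2 * z)" by (simp add: powr_diff z_def)
    also have "\<dots> \<le> ?q"
      using KbR \<open>real L \<le> 2 * z\<close> \<open>L \<ge> 2\<close> by (intro frac_le) auto
    finally have q: "2 powr (n * (2 * \<delta> - Hc)) / 2 \<le> ?q" .
    have "n * \<delta> \<le> n * (2 * \<delta> - Hc) + (1 - lv) * (n * Hc)"
    proof -
      have "n * \<delta> \<le> n * (2 * \<delta> - lv * Hc)" using lv by (intro mult_left_mono) auto
      then show ?thesis by (simp add: algebra_simps)
    qed
    then have "2 powr (n * \<delta>) / 4 \<le> 2 powr (n * (2 * \<delta> - Hc) + (1 - lv) * (n * Hc)) / 4"
      by (intro divide_right_mono powr_mono) auto
    also have "\<dots> = (2 powr (n * (2 * \<delta> - Hc)) / 2) * (2 powr ((1 - lv) * (n * Hc)) / 2)"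
      by (simp add: powr_add)
    also have "\<dots> \<le> ?q * real m" using q m by (intro mult_mono) auto
    finally have qm: "2 powr (n * \<delta>) / 4 \<le> ?q * real m" .
    have "(1 - ?q) ^ m \<le> exp (- ?q) ^ m"
      using exp_ge_add_one_self[of "- ?q"] q1 by (intro power_mono) auto
    also have "\<dots> = exp (- (?q * real m))" by (simp add: exp_of_nat_mult[symmetric] mult.commute)
    also have "\<dots> \<le> exp (- (2 powr (n * \<delta>)) / 4)" using qm by simp
    finally show ?thesis .
  qed
qed

text \<open>Each layer of the nonempty \<open>D\<close> leaves a surplus \<open>\<delta>\<close> in
  the exponent, of which the typicality tolerance spends at most
  \<open>\<delta> / 2\<close>.\<close>

lemma packing_exponent:
  fixes L :: "'s \<Rightarrow> nat" and n :: nat and H r' :: "'s \<Rightarrow> real" and \<delta> lv Hc :: real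
  assumes D: "finite D" "D \<noteq> {}" and L: "\<And>S. S \<in> D \<Longrightarrow> 2 powr (n * (H S - r' S + \<delta>)) \<le> real (L S)"
    and lv: "lv * Hc \<le> \<delta> / 2" and Hc: "(\<Sum>S\<in>D. r' S) \<le> (\<Sum>S\<in>D. H S) - Hc" and \<delta>: "\<delta> > 0"
  shows "2 powr ((1 + lv) * (n * Hc)) * (\<Prod>S\<in>D. 1 / real (L S)) \<le> 2 powr (- (n * \<delta> / 2))"
proof -
  have "(\<Prod>S\<in>D. 1 / real (L S)) \<le> (\<Prod>S\<in>D. 2 powr (- (n * (H S - r' S + \<delta>))))"
  proof (intro prod_mono conjI)
    fix S assume "S \<in> D"
    have "0 < real (L S)" by (rule less_le_trans[OF _ L[OF \<open>S \<in> D\<close>]]) simp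
    then have "1 / real (L S) \<le> 1 / 2 powr (n * (H S - r' S + \<delta>))"
      using L[OF \<open>S \<in> D\<close>] by (intro divide_left_mono) auto
    then show "1 / real (L S) \<le> 2 powr (- (n * (H S - r' S + \<delta>)))"
      by (simp only: powr_minus inverse_eq_divide)
  qed simp
  also have "\<dots> = 2 powr (\<Sum>S\<in>D. - (n * (H S - r' S + \<delta>)))"
    using D by (subst powr_sum) auto
  also have "(\<Sum>S\<in>D. - (n * (H S - r' S + \<delta>))) = - (n * ((\<Sum>S\<in>D. H S) - (\<Sum>S\<in>D. r' S) + card D * \<delta>))"
    by (simp add: sum_negf sum_distrib_left[symmetric] sum.distrib sum_subtractf)
  finally have "2 powr ((1 + lv) * (n * Hc)) * (\<Prod>S\<in>D. 1 / real (L S))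
     \<le> 2 powr ((1 + lv) * (n * Hc)) * 2 powr (- (n * ((\<Sum>S\<in>D. H S) - (\<Sum>S\<in>D. r' S) + card D * \<delta>)))"
    by (intro mult_left_mono) auto
  also have "\<dots> = 2 powr (n * (Hc + lv * Hc - ((\<Sum>S\<in>D. H S) - (\<Sum>S\<in>D. r' S) + card D * \<delta>)))"
    by (simp add: powr_add[symmetric] algebra_simps)
  also have "\<dots> \<le> 2 powr (n * (- \<delta> / 2))"
  proof (intro powr_mono mult_left_mono)
    have "1 \<le> card D" using D by (simp add: Suc_le_eq card_gt_0_iff)
    then have "1 * \<delta> \<le> card D * \<delta>" using \<delta> by (intro mult_right_mono) auto
    then show "Hc + lv * Hc - ((\<Sum>S\<in>D. H S) - (\<Sum>S\<in>D. r' S) + card D * \<delta>) \<le> - \<delta> / 2"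
      using Hc lv by simp
  qed auto
  finally show ?thesis by simp
qed

text \<open>Rounding up at most doubles each factor, hence costs one bit per layer, negligible after
  division by \<open>n\<close>.\<close>

lemma log_prod_codebook_le:
  fixes n :: nat and r :: "'s \<Rightarrow> real"
  assumes I: "finite I" and r: "\<And>S. S \<in> I \<Longrightarrow> r S \<ge> 0"
  shows "log 2 (real (\<Prod>S\<in>I. nat \<lceil>2 powr (n * r S)\<rceil>)) \<le> card I + n * (\<Sum>S\<in>I. r S)"
proof -
  have "real (\<Prod>S\<in>I. nat \<lceil>2 powr (n * r S)\<rceil>) \<le> (\<Prod>S\<in>I. 2 * 2 powr (n * r S))"
    unfolding of_nat_prod using r by (intro prod_mono conjI[OF of_nat_0_le_iff nat_ceiling_powr_le]) auto
  also have "\<dots> = (\<Prod>S\<in>I. 2 powr (1 + n * r S))" by (simp add: powr_add)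
  also have "\<dots> = 2 powr (\<Sum>S\<in>I. 1 + n * r S)" using I by (subst powr_sum) auto
  also have "(\<Sum>S\<in>I. 1 + n * r S) = card I + n * (\<Sum>S\<in>I. r S)"
    by (simp add: sum.distrib sum_distrib_left)
  finally have "real (\<Prod>S\<in>I. nat \<lceil>2 powr (n * r S)\<rceil>) \<le> 2 powr (card I + n * (\<Sum>S\<in>I. r S))" .
  moreover have "0 < real (\<Prod>S\<in>I. nat \<lceil>2 powr (n * r S)\<rceil>)" by (simp add: prod_pos)
  ultimately show ?thesis by (subst log_le_iff) auto
qed

lemma doubly_exponential_tendsto_0:
  fixes \<delta> a b :: real
  assumes "\<delta> > 0"
  shows "(\<lambda>n::nat. a * b ^ n * exp (- (2 powr (n * \<delta>)) / 4)) \<longlonglongrightarrow> 0"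
proof -
  \<comment> \<open>A base above one gives \<open>ln B > 0\<close>, as the asymptotic comparison
    requires, and it dominates \<open>b\<close> of either sign.\<close>
  define B where "B = 2 + \<bar>b\<bar>"
  have "(\<lambda>n::nat. exp (n * C) * exp (- (2 powr (n * \<delta>)) / 4)) \<longlonglongrightarrow> 0" if "C > 0" for C :: real
    using assms that by real_asymp
  then have lim: "(\<lambda>n::nat. \<bar>a\<bar> * (exp (n * ln B) * exp (- (2 powr (n * \<delta>)) / 4))) \<longlonglongrightarrow> 0"
    by (intro tendsto_mult_right_zero) (auto simp: B_def)
  show ?thesis
  proof (rule Lim_null_comparison[OF _ lim])
    have "norm (a * b ^ n * exp (- (2 powr (n * \<delta>)) / 4)) \<le> \<bar>a\<bar> * (exp (n * ln B) * exp (- (2 powr (n * \<delta>)) / 4))" for n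
    proof -
      have "\<bar>b\<bar> ^ n \<le> B ^ n" by (intro power_mono) (auto simp: B_def)
      also have "B ^ n = exp (n * ln B)" by (simp add: exp_of_nat_mult B_def)
      finally show ?thesis by (simp add: abs_mult power_abs mult.assoc mult_left_mono mult_right_mono)
    qed
    then show "\<forall>\<^sub>F n in sequentially. norm (a * b ^ n * exp (- (2 powr (n * \<delta>)) / 4)) \<le> \<bar>a\<bar> * (exp (n * ln B) * exp (- (2 powr (n * \<delta>)) / 4))"
      by simp
  qed
qed

section \<open>Achievability for a fixed ordering\<close>

lemma is_code_mono:
  assumes "is_code P d Xhat n M D f g" "\<And>l. D l \<le> D' l"
  shows "is_code P d Xhat n M D' f g"
  using assms unfolding is_code_def by (meson order_trans)

text \<open>Parameters are fixed in the order \<open>\<delta>\<close>, typicality radius, block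
  length; the code is then \<open>code_exists\<close> for good labels.\<close>

lemma achievable_of_CLP:
  fixes P :: "('x::finite \<times> ('m::finite \<Rightarrow> 'y::finite)) pmf"
    and d :: "'m \<Rightarrow> 'x \<Rightarrow> 'z \<Rightarrow> real"
  assumes X: "\<forall>l. finite (Xhat l) \<and> Xhat l \<noteq> {}" and d: "\<forall>l x z. d l x z \<ge> 0"
    and vs: "vs \<in> orderings" and p: "p \<in> Cach P d Xhat vs D" and r: "(R, R') \<in> CLP vs p"
  shows "achievable P d Xhat D (\<Sum>S\<in>nesubs. R S)"
proof -
  let ?J = "length vs" and ?I = "nesubs :: 'm set set"
  have fin: "finite (set_pmf p)" and P: "P = map_pmf snd p"
    and mk: "markov p (\<lambda>w. restrict (fst w) nesubs) (\<lambda>w. fst (snd w)) (\<lambda>w. snd (snd w))"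
    using p by (auto simp: Cach_def)
  have "\<forall>l. \<exists>g. (\<forall>u y. g u y \<in> Xhat l) \<and> measure_pmf.expectation p
            (\<lambda>w. d l (fst (snd w)) (g (restrict (fst w) (Dset l)) (snd (snd w) l))) \<le> D l"
    using p by (simp add: Cach_def)
  then obtain gl where "\<forall>l. (\<forall>u y. gl l u y \<in> Xhat l) \<and> measure_pmf.expectation p
            (\<lambda>w. d l (fst (snd w)) (gl l (restrict (fst w) (Dset l)) (snd (snd w) l))) \<le> D l"
    unfolding choice_iff by blast
  then have gl: "\<And>l u y. gl l u y \<in> Xhat l" and E: "\<And>l. measure_pmf.expectation p
            (\<lambda>w. d l (fst (snd w)) (gl l (restrict (fst w) (Dset l)) (snd (snd w) l))) \<le> D l"
    by auto
  define dm where "dm = (\<Sum>l\<in>UNIV. \<Sum>x\<in>UNIV. \<Sum>z\<in>Xhat l. d l x z)"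
  have dm: "d l x z \<le> dm" if "z \<in> Xhat l" for l x z
  proof -
    have "d l x z \<le> (\<Sum>z\<in>Xhat l. d l x z)"
      using X d that by (intro member_le_sum) auto
    also have "\<dots> \<le> (\<Sum>x\<in>UNIV. \<Sum>z\<in>Xhat l. d l x z)"
      using d by (intro member_le_sum[of x UNIV "\<lambda>x. \<Sum>z\<in>Xhat l. d l x z"]) (auto intro: sum_nonneg)
    also have "\<dots> \<le> dm" unfolding dm_def
      using d by (intro member_le_sum[of l UNIV "\<lambda>l. \<Sum>x\<in>UNIV. \<Sum>z\<in>Xhat l. d l x z"]) (auto intro!: sum_nonneg)
    finally show ?thesis .
  qed
  have dm0: "0 \<le> dm" unfolding dm_def using d by (auto intro!: sum_nonneg)
  define HS where "HS S = ent p (\<lambda>w. fst w S)" for S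
  define Hl where "Hl l D' = cent p (\<lambda>w. restrict (fst w) D') (\<lambda>w. (restrict (fst w) (Dset l - D'), snd (snd w) l))" for l D'
  define Hj where "Hj j = cent p (\<lambda>w. fst w (vs ! j)) (\<lambda>w. (fst (snd w), restrict (fst w) (set (take j vs))))" for j
  have R0: "R S \<ge> 0" if "S \<in> nesubs" for S using r that by (simp add: CLP_def)
  have cov: "HS (vs ! j) \<le> R (vs ! j) + R' (vs ! j) + Hj j" if "j < ?J" for j
    using r that unfolding CLP_def HS_def Hj_def by (auto simp: minf_eq_cent[OF fin])
  have pack: "(\<Sum>S\<in>D'. R' S) \<le> (\<Sum>S\<in>D'. HS S) - Hl l D'" if "D' \<subseteq> Dset l" "D' \<noteq> {}" for l D'
    using r that unfolding CLP_def HS_def Hl_def by auto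
  show ?thesis unfolding achievable_def
  proof (intro allI impI)
    fix \<epsilon> :: real assume \<epsilon>: "\<epsilon> > 0"
    \<comment> \<open>The codebooks exceed the rates by \<open>3 * \<delta>\<close> per layer, in
      total at most \<open>\<epsilon> / 2\<close>.\<close>
    define \<delta> where "\<delta> = \<epsilon> / (6 * (real (card ?I) + 1))"
    define HB where "HB = 1 + (\<Sum>j<?J. \<bar>Hj j\<bar>) + (\<Sum>i\<in>UNIV. \<bar>Hl (fst i) (snd i)\<bar>)"
    define DB where "DB = 1 + (\<Sum>l\<in>UNIV. \<bar>D l\<bar>)"
    \<comment> \<open>The first bound keeps \<open>e\<close> times any conditional entropy in use
      below \<open>\<delta> / 2\<close>, the second keeps the relative distortion excess below
      \<open>\<epsilon> / 2\<close>.\<close>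
    define e where "e = min (\<delta> / (2 * HB)) (\<epsilon> / (2 * DB))"
    \<comment> \<open>Splits \<open>e\<close> into \<open>J + 2\<close> increments, so that
      \<open>lev (Suc J) = e\<close>.\<close>
    define c where "c = e / (real ?J + 2)"
    \<comment> \<open>Error probability \<open>\<eta>\<close> costs distortion
      \<open>dm * \<eta> \<le> \<epsilon> / 2\<close>; each of the four error events receives a
      quarter.\<close>
    define \<eta> where "\<eta> = \<epsilon> / (2 * (1 + dm))"
    have \<delta>: "\<delta> > 0" using \<epsilon> by (simp add: \<delta>_def add_nonneg_pos)
    have HB: "HB > 0" unfolding HB_def by (intro add_pos_nonneg) (auto intro: sum_nonneg)
    have DB: "DB > 0" unfolding DB_def by (intro add_pos_nonneg) (auto intro: sum_nonneg)
    have e: "e > 0" using \<delta> HB DB \<epsilon> by (simp add: e_def)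
    have c: "c > 0" using e by (simp add: c_def)
    have \<eta>: "\<eta> > 0" using \<epsilon> dm0 by (simp add: \<eta>_def)
    have HjB: "\<bar>Hj j\<bar> \<le> HB" if "j < ?J" for j
    proof -
      have "\<bar>Hj j\<bar> \<le> (\<Sum>j<?J. \<bar>Hj j\<bar>)" using that by (intro member_le_sum) auto
      moreover have "0 \<le> (\<Sum>i\<in>UNIV. \<bar>Hl (fst i) (snd i)\<bar>)" by (rule sum_nonneg) simp
      ultimately show ?thesis unfolding HB_def by linarith
    qed
    have HlB: "\<bar>Hl l D'\<bar> \<le> HB" for l D'
    proof -
      have "\<bar>Hl l D'\<bar> \<le> (\<Sum>i\<in>UNIV. \<bar>Hl (fst i) (snd i)\<bar>)"
        using member_le_sum[of "(l, D')" UNIV "\<lambda>i. \<bar>Hl (fst i) (snd i)\<bar>"] by simp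
      moreover have "0 \<le> (\<Sum>j<?J. \<bar>Hj j\<bar>)" by (rule sum_nonneg) simp
      ultimately show ?thesis unfolding HB_def by linarith
    qed
    have DlB: "\<bar>D l\<bar> \<le> DB" for l
      using member_le_sum[of l UNIV "\<lambda>l. \<bar>D l\<bar>"] unfolding DB_def by simp
    have small: "lv * h \<le> \<delta> / 2" if "\<bar>h\<bar> \<le> HB" "0 \<le> lv" "lv \<le> e" for lv h
    proof -
      have "lv * h \<le> lv * \<bar>h\<bar>" using that by (intro mult_left_mono) auto
      also have "\<dots> \<le> (\<delta> / (2 * HB)) * HB" using that HB by (intro mult_mono) (auto simp: e_def)
      finally show ?thesis using HB by simp
    qed
    define Kb where "Kb n S = nat \<lceil>2 powr (real n * (R S + 3 * \<delta>))\<rceil>" for n S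
    \<comment> \<open>The maximum guarantees \<open>Kb \<le> L\<close> even when the exponent of the
      labels is small or negative.\<close>
    define L where "L n S = max (Kb n S) (nat \<lceil>2 powr (real n * (HS S - R' S + \<delta>))\<rceil>)" for n S
    have Kb_pos: "0 < Kb n S" for n S by (simp add: Kb_def)
    \<comment> \<open>A dummy instance that names the alphabet and the distributions, which do not
      depend on the block length, before \<open>n\<close> is chosen.\<close>
    interpret S1: scheme p vs c 1 "\<lambda>_. 1" "\<lambda>_. 1"
      by unfold_locales (use fin vs c mk in auto)
    let ?b = "real (CARD('x)) * real (card (S1.alph)) ^ card ?I"
    have ev: "\<forall>\<^sub>F n in sequentially. n > 0 \<and> real (card ?I) / real n < \<epsilon> / 2 \<and>
        (\<forall>j\<in>{..<?J}. atyp_bound (S1.stepdist j) c n < 1 / 2) \<and>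
        atyp_bound (map_pmf (S1.past 0) p) c n < \<eta> / 4 \<and>
        atyp_bound (S1.fulldist) c n < \<eta> / 4 \<and>
        real ?J * ?b ^ n * exp (- (2 powr (real n * \<delta>)) / 4) < \<eta> / 4 \<and>
        real (card (UNIV :: ('m \<times> 'm set set) set)) * 2 powr (- (real n * \<delta> / 2)) < \<eta> / 4"
    proof (intro eventually_conj)
      show "\<forall>\<^sub>F n in sequentially. n > (0::nat)" by (rule eventually_gt_at_top)
      have "(\<lambda>n. real (card ?I) / real n) \<longlonglongrightarrow> 0" by (rule lim_const_over_n)
      then show "\<forall>\<^sub>F n in sequentially. real (card ?I) / real n < \<epsilon> / 2"
        using \<epsilon> by (intro order_tendstoD(2)) auto
      show "\<forall>\<^sub>F n in sequentially. \<forall>j\<in>{..<?J}. atyp_bound (S1.stepdist j) c n < 1 / 2"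
        by (intro eventually_ball_finite ballI order_tendstoD(2)[OF atyp_bound_tendsto_0[OF S1.fin_stepdist c]]) auto
      show "\<forall>\<^sub>F n in sequentially. atyp_bound (map_pmf (S1.past 0) p) c n < \<eta> / 4"
        using \<eta> fin c by (intro order_tendstoD(2)[OF atyp_bound_tendsto_0]) auto
      show "\<forall>\<^sub>F n in sequentially. atyp_bound (S1.fulldist) c n < \<eta> / 4"
        using \<eta> c unfolding S1.fulldist_def by (intro order_tendstoD(2)[OF atyp_bound_tendsto_0[OF S1.fin_map]]) auto
      show "\<forall>\<^sub>F n in sequentially. real ?J * ?b ^ n * exp (- (2 powr (real n * \<delta>)) / 4) < \<eta> / 4"
        using \<eta> \<delta> by (intro order_tendstoD(2)[OF doubly_exponential_tendsto_0]) auto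
      have "(\<lambda>n::nat. 2 powr (- (real n * \<delta> / 2))) \<longlonglongrightarrow> 0" using \<delta> by real_asymp
      then have "(\<lambda>n::nat. real (card (UNIV :: ('m \<times> 'm set set) set)) * 2 powr (- (real n * \<delta> / 2))) \<longlonglongrightarrow> 0"
        by (rule tendsto_mult_right_zero)
      from order_tendstoD(2)[OF this, of "\<eta> / 4"]
      show "\<forall>\<^sub>F n::nat in sequentially. real (card (UNIV :: ('m \<times> 'm set set) set)) * 2 powr (- (real n * \<delta> / 2)) < \<eta> / 4"
        using \<eta> by simp
    qed
    have code: "\<exists>M f g. is_code P d Xhat n M (\<lambda>l. D l + \<epsilon>) f g \<and> log 2 (real M) / real n \<le> (\<Sum>S\<in>nesubs. R S) + \<epsilon>"
      if n: "n > 0" and nI: "real (card ?I) / real n < \<epsilon> / 2"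
        and n1: "\<And>j. j < ?J \<Longrightarrow> atyp_bound (S1.stepdist j) c n < 1 / 2"
        and n2: "atyp_bound (map_pmf (S1.past 0) p) c n < \<eta> / 4"
        and n3: "atyp_bound (S1.fulldist) c n < \<eta> / 4"
        and n4: "real ?J * ?b ^ n * exp (- (2 powr (real n * \<delta>)) / 4) < \<eta> / 4"
        and n5: "real (card (UNIV :: ('m \<times> 'm set set) set)) * 2 powr (- (real n * \<delta> / 2)) < \<eta> / 4" for n
    proof -
      interpret S: scheme p vs c n "Kb n" "L n"
        by unfold_locales (use fin vs c n Kb_pos mk in \<open>auto simp: L_def\<close>)
      have lev_e: "S.lev (Suc ?J) = e" unfolding S.lev_def by (simp add: c_def field_simps)
      have lev_le: "0 \<le> S.lev j + c" "S.lev j + c \<le> e" if "j < ?J" for j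
      proof -
        show "0 \<le> S.lev j + c" using c by (simp add: S.lev_def)
        have "(real j + 2) * c \<le> (real ?J + 2) * c" using that c by (intro mult_right_mono) auto
        moreover have "(real ?J + 2) * c = e" by (simp add: c_def)
        moreover have "S.lev j + c = (real j + 2) * c" unfolding S.lev_def by (simp add: algebra_simps)
        ultimately show "S.lev j + c \<le> e" by simp
      qed
      have g1: "measure S.lab S.noncovering \<le> \<eta> / 4"
      proof -
        have "(1 - real (Kb n (vs ! j)) / real (L n (vs ! j))) ^ card (S.cand x u (vs ! j)) \<le> exp (- (2 powr (real n * \<delta>)) / 4)"
          if j: "j < ?J" and t: "typical (map_pmf (S.past j) p) n (S.lev j) (S.pastseq j x u)" for x u j
        proof -
          obtain K where K: "kernel_of (S.stepdist j) K" using kernel_exists by blast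
          have Hj: "Hj j = kent (S.stepdist j) K"
            unfolding Hj_def S.stepdist_def S.past_def
            by (rule cent_eq_kent[OF fin]) (use K in \<open>simp add: S.stepdist_def S.past_def\<close>)
          have "map_pmf fst (S.stepdist j) = map_pmf (S.past j) p"
            by (simp add: S.stepdist_def map_pmf_comp)
          then have "2 powr ((1 - (S.lev j + c)) * (n * kent (S.stepdist j) K)) / 2
              \<le> real (card (cond_typical (S.stepdist j) n (S.lev j + c) (S.pastseq j x u)))"
            using t n1[OF j] by (intro card_cond_typical_ge[OF S.fin_stepdist K c n]) auto
          then have m: "2 powr ((1 - (S.lev j + c)) * (n * Hj j)) / 2 \<le> real (card (S.cand x u (vs ! j)))"
            unfolding S.cand_def S.idx_nth[OF j] Hj .
          have "(S.lev j + c) * Hj j \<le> \<delta>"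
            using small[OF HjB[OF j] lev_le[OF j]] \<delta> by linarith
          then show ?thesis
            by (intro covering_exponent[OF _ _ cov[OF j] _ m]) (auto simp: Kb_def L_def)
        qed
        then have "measure S.lab S.noncovering \<le> real ?J * ?b ^ n * exp (- (2 powr (real n * \<delta>)) / 4)"
          by (intro S.prob_noncovering_le) auto
        then show ?thesis using n4 by simp
      qed
      have g2: "measure S.lab {\<alpha>. S.confused \<alpha> w} \<le> \<eta> / 4" for w
      proof -
        have "measure S.lab {\<alpha>. S.confused \<alpha> w}
           \<le> real (card (UNIV :: ('m \<times> 'm set set) set)) * 2 powr (- (real n * \<delta> / 2))"
        proof (rule S.prob_confused_le)
          fix l and D' :: "'m set set" assume D': "D' \<subseteq> Dset l" "D' \<noteq> {}"
          show "2 powr ((1 + S.lev (Suc ?J)) * (real n * cent p (\<lambda>w. restrict (fst w) D')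
              (\<lambda>w. (restrict (fst w) (Dset l - D'), snd (snd w) l)))) * (\<Prod>S\<in>D'. 1 / real (L n S))
            \<le> 2 powr (- (real n * \<delta> / 2))"
            unfolding lev_e Hl_def[symmetric]
          proof (rule packing_exponent[where r'=R' and H=HS])
            show "finite D'" by simp
            show "D' \<noteq> {}" by fact
            show "(\<Sum>S\<in>D'. R' S) \<le> (\<Sum>S\<in>D'. HS S) - Hl l D'" by (rule pack[OF D'])
            show "e * Hl l D' \<le> \<delta> / 2" by (rule small[OF HlB]) (use e in auto)
            show "2 powr (n * (HS S - R' S + \<delta>)) \<le> real (L n S)" for S
              unfolding L_def by linarith
          qed (rule \<delta>)
        qed
        then show ?thesis using n5 by simp
      qed
      obtain \<alpha> where "measure S.src (S.bad \<alpha>) \<le> \<eta> / 4 + atyp_bound (map_pmf (S.past 0) p) c n + atyp_bound S.fulldist c n + \<eta> / 4"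
        using S.good_labels_exist[OF g1 g2] by blast
      then have bad: "measure S.src (S.bad \<alpha>) \<le> \<eta>" using n2 n3 by linarith
      obtain f g where fg: "is_code (map_pmf snd p) d Xhat n (\<Prod>S\<in>nesubs. Kb n S)
          (\<lambda>l. (1 + S.lev (Suc ?J)) * D l + dm * \<eta>) f g"
        using S.code_exists[OF gl _ dm bad E] d by blast
      have "is_code P d Xhat n (\<Prod>S\<in>nesubs. Kb n S) (\<lambda>l. D l + \<epsilon>) f g"
        unfolding P
      proof (rule is_code_mono[OF fg])
        fix l
        have "e * D l \<le> e * \<bar>D l\<bar>" using e by (intro mult_left_mono) auto
        also have "\<dots> \<le> (\<epsilon> / (2 * DB)) * DB" using e DlB[of l] \<epsilon> DB by (intro mult_mono) (auto simp: e_def)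
        also have "\<dots> = \<epsilon> / 2" using DB by simp
        finally have "e * D l \<le> \<epsilon> / 2" .
        moreover have "dm * \<eta> \<le> \<epsilon> / 2"
          using dm0 \<epsilon> by (simp add: \<eta>_def field_simps)
        ultimately show "(1 + S.lev (Suc ?J)) * D l + dm * \<eta> \<le> D l + \<epsilon>"
          unfolding lev_e by (simp add: algebra_simps)
      qed
      moreover have "log 2 (real (\<Prod>S\<in>nesubs. Kb n S)) / real n \<le> (\<Sum>S\<in>nesubs. R S) + \<epsilon>"
      proof -
        have "log 2 (real (\<Prod>S\<in>nesubs. Kb n S)) \<le> card ?I + n * (\<Sum>S\<in>nesubs. R S + 3 * \<delta>)"
          unfolding Kb_def using R0 \<delta> by (intro log_prod_codebook_le) (auto intro: add_nonneg_nonneg)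
        then have "log 2 (real (\<Prod>S\<in>nesubs. Kb n S)) / real n \<le> real (card ?I) / real n + (\<Sum>S\<in>nesubs. R S + 3 * \<delta>)"
          using n by (simp add: field_simps)
        also have "(\<Sum>S\<in>nesubs. R S + 3 * \<delta>) = (\<Sum>S\<in>nesubs. R S) + card ?I * (3 * \<delta>)"
          by (simp add: sum.distrib)
        also have "card ?I * (3 * \<delta>) \<le> \<epsilon> / 2"
          using \<epsilon> by (simp add: \<delta>_def field_simps)
        finally show ?thesis using nI by linarith
      qed
      ultimately show ?thesis by blast
    qed
    obtain N where N: "\<forall>n\<ge>N. n > 0 \<and> real (card ?I) / real n < \<epsilon> / 2 \<and>
        (\<forall>j\<in>{..<?J}. atyp_bound (S1.stepdist j) c n < 1 / 2) \<and>
        atyp_bound (map_pmf (S1.past 0) p) c n < \<eta> / 4 \<and>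
        atyp_bound (S1.fulldist) c n < \<eta> / 4 \<and>
        real ?J * ?b ^ n * exp (- (2 powr (real n * \<delta>)) / 4) < \<eta> / 4 \<and>
        real (card (UNIV :: ('m \<times> 'm set set) set)) * 2 powr (- (real n * \<delta> / 2)) < \<eta> / 4"
      using ev unfolding eventually_sequentially by blast
    show "\<exists>N. \<forall>n\<ge>N. \<exists>M f g. is_code P d Xhat n M (\<lambda>l. D l + \<epsilon>) f g \<and> log 2 (real M) / real n \<le> (\<Sum>S\<in>nesubs. R S) + \<epsilon>"
      by (intro exI[of _ N] allI impI code) (use N in auto)
  qed
qed

section \<open>Time sharing\<close>

text \<open>The two blocks are coded separately and the message pair is packed into one index. Head
  and tail have the block marginals, so the distortion sums add.\<close>

lemma is_code_concat:
  fixes P :: "('x::finite \<times> ('m::finite \<Rightarrow> 'y::finite)) pmf"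
  assumes n: "n1 > 0" "n2 > 0"
    and c1: "is_code P d Xhat n1 M1 D1 f1 g1" and c2: "is_code P d Xhat n2 M2 D2 f2 g2"
  shows "\<exists>f g. is_code P d Xhat (n1 + n2) (M1 * M2)
     (\<lambda>l. (real n1 * D1 l + real n2 * D2 l) / real (n1 + n2)) f g"
proof -
  have "card ({1..M1} \<times> {1..M2}) = card {1..M1 * M2}" by (simp add: card_cartesian_product)
  then obtain h where h: "bij_betw h ({1..M1} \<times> {1..M2}) {1..M1 * M2}"
    using finite_same_card_bij[of "{1..M1} \<times> {1..M2}" "{1..M1 * M2}"] by auto
  let ?u = "undefined :: 'x \<times> ('m \<Rightarrow> 'y)"
  let ?inv = "inv_into ({1..M1} \<times> {1..M2}) h"
  \<comment> \<open>Outside its block a word of pairs is \<open>undefined\<close>, so its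
    projections are padded with the components of that pair; this matches the inputs in
    \<open>is_code\<close> exactly.\<close>
  define hdx where "hdx a = (\<lambda>k. if k < n1 then a k else fst ?u)" for a :: "nat \<Rightarrow> 'x"
  define tlx where "tlx a = (\<lambda>k. if k < n2 then a (n1 + k) else fst ?u)" for a :: "nat \<Rightarrow> 'x"
  define hdy where "hdy l a = (\<lambda>k. if k < n1 then a k else snd ?u l)" for l and a :: "nat \<Rightarrow> 'y"
  define tly where "tly l a = (\<lambda>k. if k < n2 then a (n1 + k) else snd ?u l)" for l and a :: "nat \<Rightarrow> 'y"
  define f where "f xs = h (f1 (hdx xs), f2 (tlx xs))" for xs
  define g where "g l i ys k = (if k < n1 then g1 l (fst (?inv i)) (hdy l ys) k
     else g2 l (snd (?inv i)) (tly l ys) (k - n1))" for l i ys k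
  have f12: "(f1 a, f2 b) \<in> {1..M1} \<times> {1..M2}" for a b
    using c1 c2 unfolding is_code_def by auto
  have inv: "?inv (f xs) = (f1 (hdx xs), f2 (tlx xs))" for xs
    unfolding f_def using bij_betw_imp_inj_on[OF h] f12 by (intro inv_into_f_f)
  let ?W = "\<lambda>n. Pi_pmf {..<n} ?u (\<lambda>_. P)"
  let ?S1 = "\<lambda>l w. (\<Sum>k<n1. d l (fst (w k)) (g1 l (f1 (\<lambda>k. fst (w k))) (\<lambda>k. snd (w k) l) k))"
  let ?S2 = "\<lambda>l w. (\<Sum>k<n2. d l (fst (w k)) (g2 l (f2 (\<lambda>k. fst (w k))) (\<lambda>k. snd (w k) l) k))"
  let ?S = "\<lambda>l w. (\<Sum>k<n1 + n2. d l (fst (w k)) (g l (f (\<lambda>k. fst (w k))) (\<lambda>k. snd (w k) l) k))"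
  define hdw where "hdw w = (\<lambda>k. if k < n1 then w k else ?u)" for w :: "nat \<Rightarrow> 'x \<times> ('m \<Rightarrow> 'y)"
  define tlw where "tlw w = (\<lambda>k. if k < n2 then w (n1 + k) else ?u)" for w :: "nat \<Rightarrow> 'x \<times> ('m \<Rightarrow> 'y)"
  have S_eq: "?S l w = ?S1 l (hdw w) + ?S2 l (tlw w)" for l w
  proof -
    have x: "hdx (\<lambda>k. fst (w k)) = (\<lambda>k. fst (hdw w k))" "tlx (\<lambda>k. fst (w k)) = (\<lambda>k. fst (tlw w k))"
      by (auto simp: hdx_def hdw_def tlx_def tlw_def)
    have y: "hdy l (\<lambda>k. snd (w k) l) = (\<lambda>k. snd (hdw w k) l)" "tly l (\<lambda>k. snd (w k) l) = (\<lambda>k. snd (tlw w k) l)"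
      by (auto simp: hdy_def hdw_def tly_def tlw_def)
    have "?S l w = (\<Sum>k<n1. d l (fst (w k)) (g l (f (\<lambda>k. fst (w k))) (\<lambda>k. snd (w k) l) k))
       + (\<Sum>k<n2. d l (fst (w (n1 + k))) (g l (f (\<lambda>k. fst (w k))) (\<lambda>k. snd (w k) l) (n1 + k)))"
      by (induction n2) (simp_all add: add.assoc)
    also have "\<dots> = ?S1 l (hdw w) + ?S2 l (tlw w)"
      unfolding g_def inv x y by (intro arg_cong2[where f="(+)"] sum.cong) (auto simp: hdw_def tlw_def)
    finally show ?thesis .
  qed
  have hd: "map_pmf hdw (?W (n1 + n2)) = ?W n1"
    using Pi_pmf_subset[of "{..<n1 + n2}" "{..<n1}" ?u "\<lambda>_. P"] by (simp add: hdw_def[abs_def])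
  have tl: "map_pmf tlw (?W (n1 + n2)) = ?W n2"
  proof -
    have "?W n2 = map_pmf (\<lambda>w. w \<circ> (\<lambda>k. n1 + k)) (Pi_pmf {n1..<n1 + n2} ?u (\<lambda>_. P))"
      by (rule Pi_pmf_bij_betw) (auto simp: bij_betw_def inj_on_def image_add_atLeastLessThan lessThan_atLeast0 simp del: atLeast0LessThan)
    also have "Pi_pmf {n1..<n1 + n2} ?u (\<lambda>_. P) = map_pmf (\<lambda>w k. if k \<in> {n1..<n1 + n2} then w k else ?u) (?W (n1 + n2))"
      by (rule Pi_pmf_subset) auto
    finally show ?thesis by (simp add: map_pmf_comp comp_def tlw_def[abs_def])
  qed
  have fin: "finite (set_pmf (?W n))" for n :: nat
    by (simp add: set_Pi_pmf finite_PiE_dflt)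
  have "measure_pmf.expectation (?W (n1 + n2)) (\<lambda>w. (1 / real (n1 + n2)) * ?S l w)
     \<le> (real n1 * D1 l + real n2 * D2 l) / real (n1 + n2)" for l
  proof -
    have "measure_pmf.expectation (?W n1) (\<lambda>w. (1 / real n1) * ?S1 l w) \<le> D1 l"
      "measure_pmf.expectation (?W n2) (\<lambda>w. (1 / real n2) * ?S2 l w) \<le> D2 l"
      using c1 c2 unfolding is_code_def by blast+
    then have b: "measure_pmf.expectation (?W n1) (?S1 l) \<le> real n1 * D1 l"
      "measure_pmf.expectation (?W n2) (?S2 l) \<le> real n2 * D2 l"
      using n by (simp_all add: field_simps)
    have "measure_pmf.expectation (?W (n1 + n2)) (?S l)
       = measure_pmf.expectation (?W (n1 + n2)) (\<lambda>w. ?S1 l (hdw w)) + measure_pmf.expectation (?W (n1 + n2)) (\<lambda>w. ?S2 l (tlw w))"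
      unfolding S_eq by (intro Bochner_Integration.integral_add integrable_measure_pmf_finite fin)
    also have "measure_pmf.expectation (?W (n1 + n2)) (\<lambda>w. ?S1 l (hdw w)) = measure_pmf.expectation (?W n1) (?S1 l)"
      unfolding hd[symmetric] by simp
    also have "measure_pmf.expectation (?W (n1 + n2)) (\<lambda>w. ?S2 l (tlw w)) = measure_pmf.expectation (?W n2) (?S2 l)"
      unfolding tl[symmetric] by simp
    finally show ?thesis using b by (simp add: divide_right_mono)
  qed
  moreover have "f xs \<in> {1..M1 * M2}" for xs
    unfolding f_def using bij_betwE[OF h] f12 by blast
  moreover have "g l i ys k \<in> Xhat l" if "k < n1 + n2" for l i ys k
    using c1 c2 that unfolding is_code_def g_def by auto
  ultimately have "is_code P d Xhat (n1 + n2) (M1 * M2)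
     (\<lambda>l. (real n1 * D1 l + real n2 * D2 l) / real (n1 + n2)) f g"
    unfolding is_code_def by blast
  then show ?thesis by blast
qed

lemma is_code_pos: "is_code P d Xhat n M D f g \<Longrightarrow> M > 0"
  unfolding is_code_def by (metis Suc_le_eq atLeastAtMost_iff le_trans One_nat_def)

text \<open>Time sharing with a first block of about \<open>t * n\<close> symbols; rounding shifts
  at most one symbol and its cost vanishes with \<open>n\<close>.\<close>

lemma achievable_convex_combination:
  fixes P :: "('x::finite \<times> ('m::finite \<Rightarrow> 'y::finite)) pmf" and t :: real
  assumes t: "0 < t" "t < 1" and a1: "achievable P d Xhat D1 R1" and a2: "achievable P d Xhat D2 R2"
  shows "achievable P d Xhat (\<lambda>l. t * D1 l + (1 - t) * D2 l) (t * R1 + (1 - t) * R2)"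
  unfolding achievable_def
proof (intro allI impI)
  fix \<epsilon> :: real assume \<epsilon>: "\<epsilon> > 0"
  obtain N1 where N1: "\<And>n. n \<ge> N1 \<Longrightarrow> \<exists>M f g. is_code P d Xhat n M (\<lambda>l. D1 l + \<epsilon> / 2) f g \<and> log 2 (real M) / real n \<le> R1 + \<epsilon> / 2"
    using a1 \<epsilon> unfolding achievable_def by (meson half_gt_zero)
  obtain N2 where N2: "\<And>n. n \<ge> N2 \<Longrightarrow> \<exists>M f g. is_code P d Xhat n M (\<lambda>l. D2 l + \<epsilon> / 2) f g \<and> log 2 (real M) / real n \<le> R2 + \<epsilon> / 2"
    using a2 \<epsilon> unfolding achievable_def by (meson half_gt_zero)
  \<comment> \<open>A common bound on the cost of moving one symbol between the blocks, for the rate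
    and for every distortion.\<close>
  define B where "B = \<bar>R1 - R2\<bar> + (\<Sum>l\<in>UNIV. \<bar>D1 l - D2 l\<bar>)"
  have BD: "\<bar>D1 l - D2 l\<bar> \<le> B" for l
    using member_le_sum[of l UNIV "\<lambda>l. \<bar>D1 l - D2 l\<bar>"] unfolding B_def by simp
  have BR: "\<bar>R1 - R2\<bar> \<le> B" unfolding B_def by (simp add: sum_nonneg)
  \<comment> \<open>One estimate for rate and distortions: half of \<open>\<epsilon>\<close> belongs
    to the component codes, the other half absorbs the rounding error.\<close>
  have mix: "real n1 * (a + \<epsilon> / 2) + real n2 * (b + \<epsilon> / 2) \<le> real n * (t * a + (1 - t) * b + \<epsilon>)"
    if "n1 = nat \<lfloor>t * real n\<rfloor>" "n2 = n - n1" "2 * B / \<epsilon> \<le> real n" "\<bar>a - b\<bar> \<le> B" for n n1 n2 :: nat and a b :: real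
  proof -
    have "0 \<le> \<lfloor>t * real n\<rfloor>" using t by simp
    then have r1: "real n1 = of_int \<lfloor>t * real n\<rfloor>" using that(1) by simp
    have tn: "t * real n \<le> real n" using t by (simp add: mult_left_le_one_le)
    have "real n1 \<le> t * real n" "t * real n - 1 \<le> real n1" unfolding r1 by linarith+
    then have err: "\<bar>real n1 - t * real n\<bar> \<le> 1" and le: "n1 \<le> n" using tn by linarith+
    have r2: "real n2 = real n - real n1" using le that(2) by simp
    have "(real n1 - t * real n) * (a - b) \<le> \<bar>real n1 - t * real n\<bar> * \<bar>a - b\<bar>"
      by (metis abs_ge_self abs_mult)
    also have "\<dots> \<le> 1 * B" using err that(4) by (intro mult_mono) auto
    also have "\<dots> \<le> real n * \<epsilon> / 2" using that(3) \<epsilon> by (simp add: field_simps)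
    finally have "(real n1 - t * real n) * (a - b) \<le> real n * \<epsilon> / 2" .
    moreover have "real n1 * (a + \<epsilon> / 2) + real n2 * (b + \<epsilon> / 2)
        = real n * (t * a + (1 - t) * b) + (real n1 - t * real n) * (a - b) + real n * \<epsilon> / 2"
      unfolding r2 by (simp add: field_simps)
    ultimately show ?thesis by (simp add: distrib_left)
  qed
  \<comment> \<open>Both blocks become positive and long enough; the additional \<open>+ 1\<close>
    in the first term compensates the floor.\<close>
  define N where "N = nat \<lceil>max (max (real (Suc N1 + 1) / t) (real (Suc N2) / (1 - t))) (2 * B / \<epsilon>)\<rceil>"
  show "\<exists>N. \<forall>n\<ge>N. \<exists>M f g. is_code P d Xhat n M (\<lambda>l. t * D1 l + (1 - t) * D2 l + \<epsilon>) f g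
      \<and> log 2 (real M) / real n \<le> t * R1 + (1 - t) * R2 + \<epsilon>"
  proof (rule exI[of _ N], intro allI impI)
    fix n assume "n \<ge> N"
    then have "max (max (real (Suc N1 + 1) / t) (real (Suc N2) / (1 - t))) (2 * B / \<epsilon>) \<le> real n"
      unfolding N_def by linarith
    then have nn: "real (Suc N1 + 1) / t \<le> real n" "real (Suc N2) / (1 - t) \<le> real n" "2 * B / \<epsilon> \<le> real n" by auto
    define n1 where "n1 = nat \<lfloor>t * real n\<rfloor>"
    define n2 where "n2 = n - n1"
    have tn: "real (Suc N1 + 1) \<le> t * real n" using nn(1) t by (simp add: field_simps)
    have tn2: "real (Suc N2) \<le> (1 - t) * real n" using nn(2) t by (simp add: field_simps)
    have n1r: "real n1 \<le> t * real n" "t * real n - 1 \<le> real n1"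
    proof -
      have "0 \<le> \<lfloor>t * real n\<rfloor>" using t by simp
      then have "real n1 = of_int \<lfloor>t * real n\<rfloor>" by (simp add: n1_def)
      then show "real n1 \<le> t * real n" "t * real n - 1 \<le> real n1" by linarith+
    qed
    have n1: "n1 \<ge> N1" "n1 > 0" using tn n1r by linarith+
    have "real n1 + real (Suc N2) \<le> real n" using tn2 n1r by (simp add: algebra_simps)
    then have n2: "n2 \<ge> N2" "n2 > 0" "n1 + n2 = n" unfolding n2_def by linarith+
    obtain M1 f1 g1 where c1: "is_code P d Xhat n1 M1 (\<lambda>l. D1 l + \<epsilon> / 2) f1 g1" "log 2 (real M1) / real n1 \<le> R1 + \<epsilon> / 2"
      using N1[OF n1(1)] by blast
    obtain M2 f2 g2 where c2: "is_code P d Xhat n2 M2 (\<lambda>l. D2 l + \<epsilon> / 2) f2 g2" "log 2 (real M2) / real n2 \<le> R2 + \<epsilon> / 2"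
      using N2[OF n2(1)] by blast
    obtain f g where fg: "is_code P d Xhat n (M1 * M2)
      (\<lambda>l. (real n1 * (D1 l + \<epsilon> / 2) + real n2 * (D2 l + \<epsilon> / 2)) / real n) f g"
      using is_code_concat[OF n1(2) n2(2) c1(1) c2(1)] unfolding n2(3) by blast
    have n0: "real n > 0" using n2 by linarith
    have "is_code P d Xhat n (M1 * M2) (\<lambda>l. t * D1 l + (1 - t) * D2 l + \<epsilon>) f g"
    proof (rule is_code_mono[OF fg])
      fix l
      show "(real n1 * (D1 l + \<epsilon> / 2) + real n2 * (D2 l + \<epsilon> / 2)) / real n \<le> t * D1 l + (1 - t) * D2 l + \<epsilon>"
        using mix[OF n1_def n2_def nn(3) BD[of l]] n0 by (simp add: pos_divide_le_eq mult.commute)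
    qed
    moreover have "log 2 (real (M1 * M2)) / real n \<le> t * R1 + (1 - t) * R2 + \<epsilon>"
    proof -
      have "log 2 (real (M1 * M2)) = log 2 (real M1) + log 2 (real M2)"
        using is_code_pos[OF c1(1)] is_code_pos[OF c2(1)] by (simp add: log_mult)
      also have "\<dots> \<le> real n1 * (R1 + \<epsilon> / 2) + real n2 * (R2 + \<epsilon> / 2)"
        using c1(2) c2(2) n1(2) n2(2) by (intro add_mono) (simp_all add: field_simps)
      also have "\<dots> \<le> real n * (t * R1 + (1 - t) * R2 + \<epsilon>)" by (rule mix[OF n1_def n2_def nn(3) BR])
      finally show ?thesis using n0 by (simp add: pos_divide_le_eq mult.commute)
    qed
    ultimately show "\<exists>M f g. is_code P d Xhat n M (\<lambda>l. t * D1 l + (1 - t) * D2 l + \<epsilon>) f g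
      \<and> log 2 (real M) / real n \<le> t * R1 + (1 - t) * R2 + \<epsilon>" by blast
  qed
qed

text \<open>Induction on the number of points: the first \<open>k\<close> weights are renormalised
  by their sum \<open>s\<close> and combined with the last point.\<close>

lemma achievable_convex_sum:
  fixes P :: "('x::finite \<times> ('m::finite \<Rightarrow> 'y::finite)) pmf" and lam :: "nat \<Rightarrow> real"
  assumes "\<And>i. i < k \<Longrightarrow> lam i > 0" "(\<Sum>i<k. lam i) = 1" "\<And>i. i < k \<Longrightarrow> achievable P d Xhat (Ds i) (Rs i)"
  shows "achievable P d Xhat (\<lambda>l. \<Sum>i<k. lam i * Ds i l) (\<Sum>i<k. lam i * Rs i)"
  using assms
proof (induction k arbitrary: lam)
  case 0
  then show ?case by simp
next
  case (Suc k)
  show ?case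
  proof (cases "k = 0")
    case True
    then show ?thesis using Suc.prems by simp
  next
    case False
    define s where "s = (\<Sum>i<k. lam i)"
    have "s > 0" unfolding s_def using False Suc.prems(1) by (intro sum_pos) auto
    have sk: "lam k = 1 - s" using Suc.prems(2) by (simp add: s_def)
    then have "s < 1" using Suc.prems(1)[of k] by simp
    have "achievable P d Xhat (\<lambda>l. \<Sum>i<k. (lam i / s) * Ds i l) (\<Sum>i<k. (lam i / s) * Rs i)"
      using Suc.prems \<open>s > 0\<close> by (intro Suc.IH) (auto simp: sum_divide_distrib[symmetric] s_def[symmetric])
    from achievable_convex_combination[OF \<open>s > 0\<close> \<open>s < 1\<close> this Suc.prems(3)[of k]]
    have "achievable P d Xhat (\<lambda>l. s * (\<Sum>i<k. (lam i / s) * Ds i l) + (1 - s) * Ds k l)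
       (s * (\<Sum>i<k. (lam i / s) * Rs i) + (1 - s) * Rs k)" by simp
    then show ?thesis using \<open>s > 0\<close> by (simp add: sum_distrib_left sk)
  qed
qed


text \<open>Near-optimal achievable rates at the finitely many points of a convex combination are
  time-shared, and the slack tends to zero.\<close>

lemma RD_le_convex_envelope:
  fixes P :: "('x::finite \<times> ('m::finite \<Rightarrow> 'y::finite)) pmf"
  assumes F0: "\<And>D. F D \<ge> 0"
    and F: "\<And>D b. F D < ereal b \<Longrightarrow> \<exists>R<b. achievable P d Xhat D R"
  shows "RD P d Xhat D \<le> lower_convex_envelope F D"
  unfolding lower_convex_envelope_def
proof (rule Inf_greatest, clarify)
  fix k :: nat and lam :: "nat \<Rightarrow> real" and Ds :: "nat \<Rightarrow> 'm \<Rightarrow> real"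
  assume lam: "\<forall>i<k. lam i > 0" and s1: "(\<Sum>i<k. lam i) = 1" and Ds: "\<forall>l. (\<Sum>i<k. lam i * Ds i l) = D l"
  show "RD P d Xhat D \<le> (\<Sum>i<k. ereal (lam i) * F (Ds i))"
  proof (cases "\<exists>i<k. F (Ds i) = \<infinity>")
    \<comment> \<open>All weights are positive and no value is negative, so one infinite value makes
      the sum infinite.\<close>
    case True
    then have "(\<Sum>i<k. ereal (lam i) * F (Ds i)) = \<infinity>"
      using lam by (subst sum_Pinfty) auto
    then show ?thesis by simp
  next
    case False
    define Fr where "Fr i = real_of_ereal (F (Ds i))" for i
    have Fr: "F (Ds i) = ereal (Fr i)" if "i < k" for i
      using False that F0[of "Ds i"] by (auto simp: Fr_def ereal_real)
    show ?thesis
    proof (rule ereal_le_epsilon2)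
      fix e :: real assume e: "e > 0"
      \<comment> \<open>The same slack \<open>e\<close> at every point yields total slack
        \<open>e\<close>, because the weights sum to one.\<close>
      have "\<forall>i\<in>{..<k}. \<exists>R<Fr i + e. achievable P d Xhat (Ds i) R"
        using F Fr e by auto
      then obtain Rs where Rs: "\<And>i. i < k \<Longrightarrow> Rs i < Fr i + e" "\<And>i. i < k \<Longrightarrow> achievable P d Xhat (Ds i) (Rs i)"
        by (metis lessThan_iff)
      have "achievable P d Xhat (\<lambda>l. \<Sum>i<k. lam i * Ds i l) (\<Sum>i<k. lam i * Rs i)"
        using lam s1 Rs by (intro achievable_convex_sum) auto
      then have "achievable P d Xhat D (\<Sum>i<k. lam i * Rs i)" using Ds by simp
      then have "RD P d Xhat D \<le> ereal (\<Sum>i<k. lam i * Rs i)" unfolding RD_def by (auto intro: Inf_lower)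
      also have "(\<Sum>i<k. lam i * Rs i) \<le> (\<Sum>i<k. lam i * (Fr i + e))"
        using lam Rs(1) by (intro sum_mono mult_left_mono) (auto intro: less_imp_le)
      also have "\<dots> = (\<Sum>i<k. lam i * Fr i) + e"
        using s1 by (simp add: distrib_left sum.distrib sum_distrib_right[symmetric])
      also have "ereal \<dots> = (\<Sum>i<k. ereal (lam i) * F (Ds i)) + ereal e"
      proof -
        have "(\<Sum>i<k. ereal (lam i) * F (Ds i)) = (\<Sum>i<k. ereal (lam i * Fr i))"
          by (intro sum.cong) (auto simp: Fr)
        then show ?thesis by simp
      qed
      finally show "RD P d Xhat D \<le> (\<Sum>i<k. ereal (lam i) * F (Ds i)) + ereal e" by simp
    qed
  qed
qed

section \<open>The rate-distortion bound\<close>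

theorem theorem1:
  fixes P :: "('x::finite \<times> ('m::finite \<Rightarrow> 'y::finite)) pmf"
    and d :: "'m \<Rightarrow> 'x \<Rightarrow> 'z \<Rightarrow> real"
    and Xhat :: "'m \<Rightarrow> 'z set"
    and D :: "'m \<Rightarrow> real"
  assumes "\<forall>l. finite (Xhat l) \<and> Xhat l \<noteq> {}"
    and "\<forall>l x z. d l x z \<ge> 0"
  shows "RD P d Xhat D \<le> Rach P d Xhat D"
  unfolding Rach_def
proof (rule RD_le_convex_envelope)
  fix D :: "'m \<Rightarrow> real"
  \<comment> \<open>Nonnegative rates exclude negative values of the iterated infimum, as empty
    infima are infinite.\<close>
  have "0 \<le> (\<Sum>S\<in>nesubs. fst r S)" if "r \<in> CLP vs p"
    for r vs and p :: "(('m set \<Rightarrow> nat) \<times> 'x \<times> ('m \<Rightarrow> 'y)) pmf"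
    using that by (auto simp: CLP_def intro!: sum_nonneg)
  then show "0 \<le> Rach' P d Xhat D"
    unfolding Rach'_def by (intro INF_greatest) simp
next
  fix D :: "'m \<Rightarrow> real" and b :: real
  assume "Rach' P d Xhat D < ereal b"
  then obtain vs p r where "vs \<in> orderings" "p \<in> Cach P d Xhat vs D" "r \<in> CLP vs p"
    and b: "ereal (\<Sum>S\<in>nesubs. fst r S) < ereal b"
    unfolding Rach'_def INF_less_iff by blast
  then have "achievable P d Xhat D (\<Sum>S\<in>nesubs. fst r S)"
    using achievable_of_CLP[OF assms, where R="fst r" and R'="snd r"] by simp
  then show "\<exists>R<b. achievable P d Xhat D R" using b by auto
qed

end
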